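(* Let $P$ and $P'$ (the isotomic conjugate of $P$ with respect to triangle $ABC$) be ordinary points not on the (extended) sides or medians of $ABC$ or $K^{-1}(ABC)$. Then the map $\mathsf{M}=T_P\circ K^{-1}\circ T_{P'}$ is a translation if and only if any one of the following statements holds (i.e. each of the following statements is equivalent to $\mathsf{M}$ being a translation): 1. $OQQ'O'$ is a parallelogram; 2. $P$ is on the circumconic $\tilde{\mathcal{C}}_O$; 3. $O$ and $O'$ lie on the line $PP'$; 4. $Z$ lies on the line $QQ'$; 5. the signed ratio $\frac{GZ}{ZV}=\frac13$; 6. $U=K^{-1}(Z)=K(V)$, i.e. $K^{-1}(Z)$ and $K(V)$ are the same point (denoted $U$).
   Context: Work in the extended Euclidean plane (the Euclidean plane together with the line at infinity $l_\infty$); ordinary points are those not on $l_\infty$. $ABC$ is an ordinary triangle with centroid $G$. $K$ (complement map) is the homothety with center $G$ and ratio $-1/2$; $K^{-1}(ABC)$ is the anticomplementary triangle. The isotomic map $\iota$ is $(x,y,z)\mapsto(1/x,1/y,1/z)$ in homogeneous barycentric coordinates. For $P$ not on the extended sides of $ABC$ or $K^{-1}(ABC)$: $P'=\iota(P)$, $Q=K(P')$, $Q'=K(P)$; $D,E,F$ are the traces of $P$ on $BC,CA,AB$ (i.e. $D=AP\cap BC$, etc.); $D_3,E_3,F_3$ are the traces of $P'$. $T_P$ and $T_{P'}$ are the unique affine maps taking $A,B,C$ to $D,E,F$ and to $D_3,E_3,F_3$, respectively. The generalized circumcenters of $P$ and $P'$ are $O=T_{P'}^{-1}\circ K(Q)$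 and $O'=T_P^{-1}\circ K(Q')$. $\mathcal{N}_{P'}$ is the nine-point conic of the quadrangle $ABCP'$ (the conic through the midpoints of its six sides and its three diagonal points), and $\tilde{\mathcal{C}}_O=T_{P'}^{-1}(\mathcal{N}_{P'})$, a circumconic of $ABC$ with center $O$. $V=PQ\cap P'Q'$. $\mathcal{C}_P=ABCPQ$ is the conic through $A,B,C,P,Q$ (it also passes through $P'$ and $Q'$), and $Z$ is its center (the pole of $l_\infty$ with respect to $\mathcal{C}_P$); $Z$ lies on the line $GV$. *)

theory Defs
  imports "HOL-Analysis.Analysis"
begin

text \<open>
  The extended Euclidean plane is the projective plane of the vector space
  \<open>(real^2) \<times> real\<close>: its points are the one-dimensional subspaces, its lines the two-dimensional
  subspaces, and a point lies on a line iff it is a subset of it.  The ordinary point \<open>X\<close> is the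
  subspace spanned by \<open>(X, 1)\<close>; the line at infinity is the plane \<open>{(v, 0) | v}\<close>.
  Points that are always ordinary are kept as elements of \<open>real^2\<close>; \<open>pt\<close> embeds them.
\<close>

type_synonym plane = "real^2"
type_synonym homog = "(real^2) \<times> real"

definition ext_point :: "homog set \<Rightarrow> bool" where
  "ext_point p \<longleftrightarrow> subspace p \<and> dim p = 1"

definition hom :: "plane \<Rightarrow> homog" where
  "hom X = (X, 1)"

definition pt :: "plane \<Rightarrow> homog set" where
  "pt X = span {hom X}"

definition line_infinity :: "homog set" where
  "line_infinity = {(v, t). t = 0}"

definition join :: "homog set \<Rightarrow> homog set \<Rightarrow> homog set" where
  "join p q = span (p \<union> q)"

definition affine_map :: "(plane \<Rightarrow> plane) \<Rightarrow> bool" where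
  "affine_map f \<longleftrightarrow> (\<exists>L c. linear L \<and> f = (\<lambda>x. L x + c))"

text \<open>
  The projective extension of an affine map \<open>f x = L x + c\<close>; it is induced by the linear map
  \<open>(v, t) \<mapsto> (L v + t c, t)\<close>, where \<open>L v = f v - f 0\<close> and \<open>c = f 0\<close>.
\<close>

definition ext_map :: "(plane \<Rightarrow> plane) \<Rightarrow> homog set \<Rightarrow> homog set" where
  "ext_map f p = (\<lambda>(v, t). (f v - f 0 + t *\<^sub>R f 0, t)) ` p"

definition translation_map :: "(plane \<Rightarrow> plane) \<Rightarrow> bool" where
  "translation_map f \<longleftrightarrow> (\<exists>t. \<forall>x. f x = x + t)"

definition centroid :: "plane \<Rightarrow> plane \<Rightarrow> plane \<Rightarrow> plane" where
  "centroid A B C = (1/3) *\<^sub>R (A + B + C)"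

definition complement_map :: "plane \<Rightarrow> plane \<Rightarrow> plane \<Rightarrow> plane \<Rightarrow> plane" where
  "complement_map A B C X = centroid A B C + (-1/2) *\<^sub>R (X - centroid A B C)"

definition on_side :: "plane \<Rightarrow> plane \<Rightarrow> plane \<Rightarrow> plane \<Rightarrow> bool" where
  "on_side A B C X \<longleftrightarrow>
     X \<in> affine hull {B, C} \<or> X \<in> affine hull {C, A} \<or> X \<in> affine hull {A, B}"

definition on_median :: "plane \<Rightarrow> plane \<Rightarrow> plane \<Rightarrow> plane \<Rightarrow> bool" where
  "on_median A B C X \<longleftrightarrow>
     X \<in> affine hull {A, midpoint B C} \<or> X \<in> affine hull {B, midpoint C A} \<or>
     X \<in> affine hull {C, midpoint A B}"

text \<open>The point with homogeneous barycentric coordinates \<open>(x, y, z)\<close>, not all zero.\<close>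

definition bary :: "plane \<Rightarrow> plane \<Rightarrow> plane \<Rightarrow> real \<Rightarrow> real \<Rightarrow> real \<Rightarrow> homog set" where
  "bary A B C x y z = span {x *\<^sub>R hom A + y *\<^sub>R hom B + z *\<^sub>R hom C}"

definition isotomic :: "plane \<Rightarrow> plane \<Rightarrow> plane \<Rightarrow> homog set \<Rightarrow> homog set" where
  "isotomic A B C p = (THE q. \<exists>x y z. x \<noteq> 0 \<and> y \<noteq> 0 \<and> z \<noteq> 0 \<and>
     p = bary A B C x y z \<and> q = bary A B C (1/x) (1/y) (1/z))"

text \<open>
  The trace on the line \<open>BC\<close> of a point \<open>X\<close>.  It is an ordinary point whenever \<open>AX\<close> is not parallel
  to \<open>BC\<close>, i.e. \<open>X\<close> is not on the side through \<open>A\<close> of the anticomplementary triangle.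
\<close>

definition cevian_trace :: "plane \<Rightarrow> plane \<Rightarrow> plane \<Rightarrow> plane \<Rightarrow> plane" where
  "cevian_trace A B C X = the_elem (affine hull {A, X} \<inter> affine hull {B, C})"

definition cevian_map :: "plane \<Rightarrow> plane \<Rightarrow> plane \<Rightarrow> plane \<Rightarrow> (plane \<Rightarrow> plane)" where
  "cevian_map A B C X = (THE f. affine_map f \<and>
     f A = cevian_trace A B C X \<and> f B = cevian_trace B C A X \<and> f C = cevian_trace C A B X)"

text \<open>
  Conics are nondegenerate and are given by their sets of points.  A conic with a real point
  determines its symmetric bilinear form up to a nonzero factor.
\<close>

definition conic_form :: "(homog \<Rightarrow> homog \<Rightarrow> real) \<Rightarrow> bool" where
  "conic_form b \<longleftrightarrow> bilinear b \<and> (\<forall>u v. b u v = b v u) \<and> (\<forall>u. (\<forall>v. b u v = 0) \<longrightarrow> u = 0)"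

definition conic_of :: "(homog \<Rightarrow> homog \<Rightarrow> real) \<Rightarrow> homog set set" where
  "conic_of b = {p. ext_point p \<and> (\<forall>v\<in>p. b v v = 0)}"

definition is_conic :: "homog set set \<Rightarrow> bool" where
  "is_conic S \<longleftrightarrow> S \<noteq> {} \<and> (\<exists>b. conic_form b \<and> S = conic_of b)"

definition conic_through :: "homog set set \<Rightarrow> homog set set" where
  "conic_through X = (THE S. is_conic S \<and> X \<subseteq> S)"

definition pole :: "homog set set \<Rightarrow> homog set \<Rightarrow> homog set" where
  "pole S l = (THE p. \<exists>b. conic_form b \<and> S = conic_of b \<and> p = {u. \<forall>v\<in>l. b u v = 0})"

definition conic_center :: "homog set set \<Rightarrow> homog set" where
  "conic_center S = pole S line_infinity"

definition nine_point_conic :: "plane \<Rightarrow> plane \<Rightarrow> plane \<Rightarrow> plane \<Rightarrow> homog set set" where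
  "nine_point_conic A B C D = conic_through
     {pt (midpoint A B), pt (midpoint B C), pt (midpoint C A),
      pt (midpoint A D), pt (midpoint B D), pt (midpoint C D),
      join (pt A) (pt D) \<inter> join (pt B) (pt C),
      join (pt B) (pt D) \<inter> join (pt C) (pt A),
      join (pt C) (pt D) \<inter> join (pt A) (pt B)}"

definition parallelogram :: "plane \<Rightarrow> plane \<Rightarrow> plane \<Rightarrow> plane \<Rightarrow> bool" where
  "parallelogram a b c d \<longleftrightarrow> \<not> collinear {a, b, c} \<and> b - a = c - d"

text \<open>
  The signed ratio \<open>XY/YW\<close> of ordinary collinear points equals \<open>r\<close>, where \<open>Y \<noteq> W\<close>.
\<close>

definition signed_ratio_eq :: "homog set \<Rightarrow> homog set \<Rightarrow> homog set \<Rightarrow> real \<Rightarrow> bool" where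
  "signed_ratio_eq p q s r \<longleftrightarrow>
     (\<exists>X Y W. p = pt X \<and> q = pt Y \<and> s = pt W \<and> Y \<noteq> W \<and> Y - X = r *\<^sub>R (W - Y))"

end

theory Submission
  imports Defs
begin

text \<open>
  In barycentric coordinates with respect to \<open>ABC\<close> write \<open>P = (p : q : r)\<close>, so that
  \<open>P' = (qr : rp : pq)\<close>, and put \<open>N = pqr\<close>, \<open>k = (q + r)(r + p)(p + q)\<close>,
  \<open>\<Delta> = (p - q)(q - r)(r - p)\<close>, \<open>s = p + q + r\<close>, \<open>w = pq + qr + rp\<close>.  The hypotheses say exactly
  that none of these five numbers vanishes.  Every statement of the theorem expresses
  one and the same condition on \<open>P\<close>: that it lies on the cubic curve
  \<open>\<Gamma> = p\<^sup>2(q + r) + q\<^sup>2(r + p) + r\<^sup>2(p + q) + 6pqr = 0\<close>.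

  The map \<open>M\<close> is affine, and its values at the three vertices show that it multiplies all
  vectors by \<open>-4N/k\<close>.  It is a translation iff \<open>k + 4N = 0\<close>, and \<open>k + 4N = \<Gamma>\<close>
  (\<open>translation_iff\<close>).  The first four conditions become polynomials in which \<open>\<Gamma>\<close> splits off
  with a cofactor that cannot vanish:

  \<^item> \<open>(Q - O) - (Q' - O')\<close> is \<open>\<Gamma>/(8Nsw)\<close> times a vector that vanishes only if \<open>P = G\<close>, and
    \<open>O\<close>, \<open>Q\<close>, \<open>Q'\<close> are never collinear, their determinant being \<open>2\<Delta>kw\<close>
    (\<open>parallelogram_iff\<close>).
  \<^item> The quadratic form of the nine-point conic takes the value \<open>-4Nk\<Gamma>\<close> at \<open>T\<^sub>P'(P)\<close>
    (\<open>circumconic_iff\<close>).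
  \<^item> The determinants of \<open>O, P, P'\<close> and of \<open>O', P, P'\<close> are \<open>\<Delta>w\<Gamma>\<close> and \<open>\<Delta>s\<Gamma>\<close>
    (\<open>circumcenter_on_join\<close>).
  \<^item> The determinant of \<open>Z, Q, Q'\<close> is \<open>\<Delta>\<Gamma>\<close> (\<open>center_on_join_iff\<close>).

  For the last two conditions let \<open>u = (p(q\<^sup>2 + r\<^sup>2), q(r\<^sup>2 + p\<^sup>2), r(p\<^sup>2 + q\<^sup>2))\<close>.  The coordinates of
  \<open>Z\<close> and \<open>V\<close> are \<open>u - 2N\<close> and \<open>u + N\<close> (with \<open>N\<close> taken in each place), with sums \<open>\<Gamma> - 12N\<close> and
  \<open>\<Gamma> - 3N = sw\<close>.  Hence \<open>V\<close> is always ordinary, whereas \<open>Z\<close> may lie at infinity.  Both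
  conditions amount to \<open>4Z = 3G + V\<close>.  As \<open>P\<close> is not \<open>G\<close>, the three entries of \<open>u\<close> are not all
  equal, so the coefficient of \<open>u\<close> and the constant term in this equation can be compared
  separately; that again leaves \<open>\<Gamma> = 0\<close> (\<open>signed_ratio_iff\<close>, \<open>complement_iff\<close>).

  Conics enter only through the uniqueness of the form that vanishes at the given points,
  up to a factor (\<open>conic_through_qform\<close>); this turns the definite descriptions of
  the two conics and of the center into explicit equations.
\<close>

section \<open>Barycentric coordinates with respect to a triangle\<close>

text \<open>
  The ordinary point \<open>(x : y : z)\<close>.  Division by the coordinate sum makes it homogeneous, so that
  all coordinates can be given as polynomials; it is the junk value \<open>0\<close> if the sum is zero.
\<close>

definition bary_point :: "plane \<Rightarrow> plane \<Rightarrow> plane \<Rightarrow> real \<Rightarrow> real \<Rightarrow> real \<Rightarrow> plane" where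
  "bary_point A B C x y z = (1 / (x + y + z)) *\<^sub>R (x *\<^sub>R A + y *\<^sub>R B + z *\<^sub>R C)"

lemma bary_point_rotate: "bary_point B C A y z x = bary_point A B C x y z"
  by (simp add: bary_point_def add_ac)

lemma bary_point_cong:
  assumes "x' = c * x" "y' = c * y" "z' = c * z" "c \<noteq> 0"
  shows "bary_point A B C x' y' z' = bary_point A B C x y z"
proof -
  have "x' + y' + z' = c * (x + y + z)"
    using assms by (simp add: algebra_simps)
  moreover have "x' *\<^sub>R A + y' *\<^sub>R B + z' *\<^sub>R C = c *\<^sub>R (x *\<^sub>R A + y *\<^sub>R B + z *\<^sub>R C)"
    using assms by (simp add: algebra_simps)
  ultimately show ?thesis
    using assms(4) by (simp add: bary_point_def)
qed

locale triangle =
  fixes A B C :: plane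
  assumes non_collinear: "\<not> collinear {A, B, C}"
begin

abbreviation bp :: "real \<Rightarrow> real \<Rightarrow> real \<Rightarrow> plane" where
  "bp \<equiv> bary_point A B C"

text \<open>
  In homogeneous coordinates the three vertices form a basis.  Unlike \<open>bp\<close>, the vector \<open>hvec x y z\<close>
  is linear in the coordinates and also covers the points at infinity, which are those with
  \<open>x + y + z = 0\<close>.
\<close>

definition hvec :: "real \<Rightarrow> real \<Rightarrow> real \<Rightarrow> homog" where
  "hvec x y z = x *\<^sub>R hom A + y *\<^sub>R hom B + z *\<^sub>R hom C"

lemma hvec_add: "hvec x y z + hvec x' y' z' = hvec (x + x') (y + y') (z + z')"
  by (simp add: hvec_def algebra_simps)

lemma hvec_scaleR: "c *\<^sub>R hvec x y z = hvec (c * x) (c * y) (c * z)"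
  by (simp add: hvec_def algebra_simps)

lemma hvec_diff: "hvec x y z - hvec x' y' z' = hvec (x - x') (y - y') (z - z')"
  by (simp add: hvec_def algebra_simps)

lemma hvec_components:
  "fst (hvec x y z) = x *\<^sub>R A + y *\<^sub>R B + z *\<^sub>R C" "snd (hvec x y z) = x + y + z"
  by (simp_all add: hvec_def hom_def)

lemma hvec_vertex: "hvec 1 0 0 = hom A" "hvec 0 1 0 = hom B" "hvec 0 0 1 = hom C"
  by (simp_all add: hvec_def)

lemma hvec_eq_0_iff: "hvec x y z = 0 \<longleftrightarrow> x = 0 \<and> y = 0 \<and> z = 0"
proof
  assume "hvec x y z = 0"
  then have lin: "x *\<^sub>R A + y *\<^sub>R B + z *\<^sub>R C = 0" and sum: "x + y + z = 0"
    by (metis hvec_components(1) fst_zero, metis hvec_components(2) snd_zero)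
  have x: "x = - y - z" using sum by simp
  have 1: "y *\<^sub>R (B - A) + z *\<^sub>R (C - A) = 0"
    using lin unfolding x by (simp add: algebra_simps)
  have "y = 0"
  proof (rule ccontr)
    assume y: "y \<noteq> 0"
    have "(1/y) *\<^sub>R (y *\<^sub>R (B - A) + z *\<^sub>R (C - A)) = 0" using 1 by simp
    then have "B = (1 + z/y) *\<^sub>R A + (1 - (1 + z/y)) *\<^sub>R C"
      using y by (simp add: algebra_simps)
    then show False using non_collinear unfolding collinear_3_expand by blast
  qed
  moreover have "A \<noteq> C" using non_collinear by (auto simp: insert_commute)
  ultimately show "x = 0 \<and> y = 0 \<and> z = 0" using 1 x by simp
qed (simp add: hvec_def)

lemma hvec_inject: "hvec x y z = hvec x' y' z' \<longleftrightarrow> x = x' \<and> y = y' \<and> z = z'"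
  using hvec_eq_0_iff[of "x - x'" "y - y'" "z - z'"] by (simp flip: hvec_diff)

text \<open>
  Three independent vectors span the space \<open>(real^2) \<times> real\<close>, since it has dimension three.
\<close>

lemma hvec_surj: obtains x y z where "v = hvec x y z"
proof -
  have a: "hom A \<noteq> hom B" "hom A \<noteq> hom C" "hom B \<noteq> hom C"
    by (simp_all flip: hvec_vertex add: hvec_inject)
  have indep: "independent {hom A, hom B, hom C}"
  proof -
    have "hom A \<notin> span {hom B, hom C}"
    proof
      assume "hom A \<in> span {hom B, hom C}"
      then obtain k l where "hom A - k *\<^sub>R hom B = l *\<^sub>R hom C"
        by (auto simp: span_breakdown_eq span_singleton)
      then have "hvec 1 (-k) (-l) = 0" by (simp add: hvec_def algebra_simps)
      then show False by (simp add: hvec_eq_0_iff)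
    qed
    moreover have "hom B \<notin> span {hom C}"
    proof
      assume "hom B \<in> span {hom C}"
      then obtain l where "hom B = l *\<^sub>R hom C"
        by (auto simp: span_singleton)
      then have "hvec 0 1 (-l) = 0" by (simp add: hvec_def algebra_simps)
      then show False by (simp add: hvec_eq_0_iff)
    qed
    moreover have "hom C \<noteq> 0" by (simp add: hom_def zero_prod_def)
    ultimately show ?thesis using a by (simp add: independent_insert)
  qed
  have "dim (UNIV :: homog set) \<le> card {hom A, hom B, hom C}"
    using a by (simp add: dim_UNIV)
  then have "v \<in> span {hom A, hom B, hom C}"
    using card_ge_dim_independent[OF subset_UNIV indep] by blast
  then obtain k l m where "v - k *\<^sub>R hom A - l *\<^sub>R hom B = m *\<^sub>R hom C"
    by (auto simp: span_breakdown_eq span_singleton)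
  then have "v = hvec k l m" by (simp add: hvec_def algebra_simps)
  then show ?thesis by (rule that)
qed

lemma hom_bp: "x + y + z \<noteq> 0 \<Longrightarrow> hom (bp x y z) = (1 / (x + y + z)) *\<^sub>R hvec x y z"
  by (simp add: hom_def prod_eq_iff hvec_components bary_point_def)

lemma bp_surj: obtains x y z where "X = bp x y z" "x + y + z = 1"
proof -
  obtain x y z where "hom X = hvec x y z" by (rule hvec_surj)
  then have "X = x *\<^sub>R A + y *\<^sub>R B + z *\<^sub>R C" "x + y + z = 1"
    by (metis fst_conv hom_def hvec_components(1), metis snd_conv hom_def hvec_components(2))
  then show ?thesis using that by (simp add: bary_point_def)
qed

lemma bp_inject:
  assumes "bp x y z = bp x' y' z'" and "x + y + z \<noteq> 0" and "x' + y' + z' \<noteq> 0"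
  shows "x * (x' + y' + z') = x' * (x + y + z)"
    and "y * (x' + y' + z') = y' * (x + y + z)"
    and "z * (x' + y' + z') = z' * (x + y + z)"
proof -
  have "hom (bp x y z) = hom (bp x' y' z')" using assms(1) by simp
  then show "x * (x' + y' + z') = x' * (x + y + z)"
    and "y * (x' + y' + z') = y' * (x + y + z)"
    and "z * (x' + y' + z') = z' * (x + y + z)"
    using assms(2,3) by (simp_all add: hom_bp hvec_scaleR hvec_inject frac_eq_eq)
qed

lemma bp_vertex: "bp 1 0 0 = A" "bp 0 1 0 = B" "bp 0 0 1 = C"
  by (simp_all add: bary_point_def)

section \<open>Points and lines of the extended plane in coordinates\<close>

lemma span_scaleR: "c \<noteq> (0::real) \<Longrightarrow> span {c *\<^sub>R v} = span {v :: homog}"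
proof (intro equalityI span_minimal subspace_span)
  assume c: "c \<noteq> 0"
  have "(1/c) *\<^sub>R c *\<^sub>R v \<in> span {c *\<^sub>R v}" by (intro span_scale span_base) simp
  then show "{v} \<subseteq> span {c *\<^sub>R v}" using c by simp
qed (simp add: span_scale span_base)

lemma bary_hvec: "bary A B C x y z = span {hvec x y z}"
  by (simp add: bary_def hvec_def)

lemma pt_bp: "x + y + z \<noteq> 0 \<Longrightarrow> pt (bp x y z) = bary A B C x y z"
  by (simp add: pt_def bary_hvec hom_bp span_scaleR del: scaleR_left.add)

lemma bary_scale: "c \<noteq> 0 \<Longrightarrow> bary A B C (c * x) (c * y) (c * z) = bary A B C x y z"
  by (simp add: bary_hvec span_scaleR flip: hvec_scaleR)

lemma mem_bary_iff: "hvec x y z \<in> bary A B C a b c \<longleftrightarrow> (\<exists>k. x = k * a \<and> y = k * b \<and> z = k * c)"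
  by (auto simp: bary_hvec span_singleton hvec_scaleR hvec_inject)

lemma bary_eqD:
  assumes "bary A B C x y z = bary A B C a b c"
  obtains k where "x = k * a" "y = k * b" "z = k * c"
proof -
  have "hvec x y z \<in> bary A B C x y z" by (simp add: bary_hvec span_base)
  then show ?thesis using that unfolding assms mem_bary_iff by blast
qed

lemma pt_inject: "pt X = pt Y \<longleftrightarrow> X = Y"
proof
  assume "pt X = pt Y"
  then have "hom X \<in> span {hom Y}" by (metis pt_def span_base insertI1)
  then show "X = Y" by (auto simp: span_singleton hom_def)
qed simp

lemma span_singleton_subset_iff: "span {v :: homog} \<subseteq> span S \<longleftrightarrow> v \<in> span S"
  using span_minimal[OF _ subspace_span, of "{v}" S] span_base[of v "{v}"] by auto

lemma bary_subset_iff: "bary A B C x y z \<subseteq> span S \<longleftrightarrow> hvec x y z \<in> span S"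
  unfolding bary_hvec by (rule span_singleton_subset_iff)

lemma join_bary:
  "join (bary A B C x y z) (bary A B C x' y' z') = span {hvec x y z, hvec x' y' z'}"
  unfolding join_def bary_hvec
proof (rule antisym)
  show "span (span {hvec x y z} \<union> span {hvec x' y' z'}) \<subseteq> span {hvec x y z, hvec x' y' z'}"
    by (intro span_minimal Un_least span_mono subspace_span) auto
  show "span {hvec x y z, hvec x' y' z'} \<subseteq> span (span {hvec x y z} \<union> span {hvec x' y' z'})"
    by (intro span_mono) (auto intro: span_base)
qed

lemma mem_join_iff:
  "hvec x y z \<in> join (bary A B C a b c) (bary A B C a' b' c') \<longleftrightarrow>
    (\<exists>s t. x = s * a + t * a' \<and> y = s * b + t * b' \<and> z = s * c + t * c')"
proof -
  have "hvec x y z \<in> join (bary A B C a b c) (bary A B C a' b' c') \<longleftrightarrow>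
    (\<exists>s t. hvec x y z - s *\<^sub>R hvec a b c = t *\<^sub>R hvec a' b' c')"
    unfolding join_bary span_breakdown_eq span_singleton by blast
  then show ?thesis unfolding hvec_scaleR hvec_diff hvec_inject by (simp add: diff_eq_eq add.commute)
qed

lemma mem_joinD:
  assumes "hvec x y z \<in> join (bary A B C a b c) (bary A B C a' b' c')"
  shows "x * (b * c' - c * b') + y * (c * a' - a * c') + z * (a * b' - b * a') = 0"
proof -
  obtain s t where "x = s * a + t * a'" "y = s * b + t * b'" "z = s * c + t * c'"
    using assms unfolding mem_join_iff by blast
  then show ?thesis by algebra
qed

text \<open>
  Cramer's rule: a nonzero entry of the cross product of the two spanning vectors is the
  determinant of a solvable \<open>2 \<times> 2\<close> system for the coefficients.
\<close>

lemma mem_joinI: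
  assumes eq: "x * (b * c' - c * b') + y * (c * a' - a * c') + z * (a * b' - b * a') = 0"
    and "b * c' - c * b' \<noteq> 0 \<or> c * a' - a * c' \<noteq> 0 \<or> a * b' - b * a' \<noteq> 0"
  shows "hvec x y z \<in> join (bary A B C a b c) (bary A B C a' b' c')"
proof -
  have *: "hvec x y z \<in> join (bary A B C a b c) (bary A B C a' b' c')"
    if "l \<noteq> 0" "l * x = s * a + t * a'" "l * y = s * b + t * b'" "l * z = s * c + t * c'" for l s t
    unfolding mem_join_iff using that
    by (intro exI[of _ "s / l"] exI[of _ "t / l"]) (simp add: eq_divide_eq mult.commute flip: add_divide_distrib)
  from assms(2) show ?thesis
  proof (elim disjE)
    assume "b * c' - c * b' \<noteq> 0"
    from this show ?thesis
      by (rule *[of _ "y * c' - z * b'" "z * b - y * c"]) ((algebra | use eq in algebra)+)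
  next
    assume "c * a' - a * c' \<noteq> 0"
    from this show ?thesis
      by (rule *[of _ "z * a' - x * c'" "x * c - z * a"]) ((algebra | use eq in algebra)+)
  next
    assume "a * b' - b * a' \<noteq> 0"
    from this show ?thesis
      by (rule *[of _ "x * b' - y * a'" "y * a - x * b"]) ((algebra | use eq in algebra)+)
  qed
qed

lemma bary_subset_join_iff:
  assumes "b * c' - c * b' \<noteq> 0 \<or> c * a' - a * c' \<noteq> 0 \<or> a * b' - b * a' \<noteq> 0"
  shows "bary A B C x y z \<subseteq> join (bary A B C a b c) (bary A B C a' b' c') \<longleftrightarrow>
    x * (b * c' - c * b') + y * (c * a' - a * c') + z * (a * b' - b * a') = 0"
  using mem_joinD mem_joinI[OF _ assms] unfolding join_bary bary_subset_iff by blast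

text \<open>
  Lines are represented by the cross products \<open>l\<close> and \<open>m\<close> of their spanning vectors, and their
  intersection by \<open>l \<times> m\<close>.  The factor \<open>k\<close> makes it possible to state the intersection
  with common factors cancelled.
\<close>

lemma meet_joins:
  assumes l: "l1 = b * c' - c * b'" "l2 = c * a' - a * c'" "l3 = a * b' - b * a'"
    and m: "m1 = e * f' - f * e'" "m2 = f * d' - d * f'" "m3 = d * e' - e * d'"
    and k: "k * v1 = l2 * m3 - l3 * m2" "k * v2 = l3 * m1 - l1 * m3" "k * v3 = l1 * m2 - l2 * m1"
    and nz: "k \<noteq> 0" "v1 \<noteq> 0 \<or> v2 \<noteq> 0 \<or> v3 \<noteq> 0"
  shows "join (bary A B C a b c) (bary A B C a' b' c') \<inter> join (bary A B C d e f) (bary A B C d' e' f')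
    = bary A B C v1 v2 v3"
proof -
  have lnz: "l1 \<noteq> 0 \<or> l2 \<noteq> 0 \<or> l3 \<noteq> 0" and mnz: "m1 \<noteq> 0 \<or> m2 \<noteq> 0 \<or> m3 \<noteq> 0"
    using k nz by auto
  have "hvec x y z \<in> join (bary A B C a b c) (bary A B C a' b' c') \<inter>
          join (bary A B C d e f) (bary A B C d' e' f') \<longleftrightarrow> hvec x y z \<in> bary A B C v1 v2 v3" for x y z
  proof -
    have "hvec x y z \<in> join (bary A B C a b c) (bary A B C a' b' c') \<longleftrightarrow> x * l1 + y * l2 + z * l3 = 0"
      using mem_joinD[of x y z a b c a' b' c'] mem_joinI[of x b c' c b' y a' a z] lnz unfolding l by blast
    moreover have "hvec x y z \<in> join (bary A B C d e f) (bary A B C d' e' f') \<longleftrightarrow> x * m1 + y * m2 + z * m3 = 0"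
      using mem_joinD[of x y z d e f d' e' f'] mem_joinI[of x e f' f e' y d' d z] mnz unfolding m by blast
    moreover have "x * l1 + y * l2 + z * l3 = 0 \<and> x * m1 + y * m2 + z * m3 = 0 \<longleftrightarrow> hvec x y z \<in> bary A B C v1 v2 v3"
    proof
      assume eqs: "x * l1 + y * l2 + z * l3 = 0 \<and> x * m1 + y * m2 + z * m3 = 0"
      then have "y * (k * v3) = z * (k * v2)" "z * (k * v1) = x * (k * v3)" "x * (k * v2) = y * (k * v1)"
        unfolding k by algebra+
      then have par: "y * v3 = z * v2" "z * v1 = x * v3" "x * v2 = y * v1" using nz(1) by simp_all
      from nz(2) show "hvec x y z \<in> bary A B C v1 v2 v3" unfolding mem_bary_iff
      proof (elim disjE)
        assume "v1 \<noteq> 0"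
        then show "\<exists>k. x = k * v1 \<and> y = k * v2 \<and> z = k * v3"
          using par by (intro exI[of _ "x / v1"]) (simp add: field_simps)
      next
        assume "v2 \<noteq> 0"
        then show "\<exists>k. x = k * v1 \<and> y = k * v2 \<and> z = k * v3"
          using par by (intro exI[of _ "y / v2"]) (simp add: field_simps)
      next
        assume "v3 \<noteq> 0"
        then show "\<exists>k. x = k * v1 \<and> y = k * v2 \<and> z = k * v3"
          using par by (intro exI[of _ "z / v3"]) (simp add: field_simps)
      qed
    next
      assume "hvec x y z \<in> bary A B C v1 v2 v3"
      then obtain h where h: "x = h * v1" "y = h * v2" "z = h * v3" unfolding mem_bary_iff by blast
      have "k * (v1 * l1 + v2 * l2 + v3 * l3) = 0" "k * (v1 * m1 + v2 * m2 + v3 * m3) = 0"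
        using k by algebra+
      then have "v1 * l1 + v2 * l2 + v3 * l3 = 0" "v1 * m1 + v2 * m2 + v3 * m3 = 0" using nz(1) by simp_all
      then show "x * l1 + y * l2 + z * l3 = 0 \<and> x * m1 + y * m2 + z * m3 = 0"
        unfolding h by algebra
    qed
    ultimately show ?thesis by blast
  qed
  then show ?thesis by (metis (no_types, lifting) hvec_surj set_eqI)
qed

lemma collinear_bpD:
  assumes "collinear {bp x y z, bp a b c, bp a' b' c'}"
    and "x + y + z \<noteq> 0" "a + b + c \<noteq> 0" "a' + b' + c' \<noteq> 0"
  shows "x * (b * c' - c * b') + y * (c * a' - a * c') + z * (a * b' - b * a') = 0"
proof -
  have "collinear {bp a b c, bp x y z, bp a' b' c'}" using assms(1) by (simp add: insert_commute)
  then consider "bp a b c = bp a' b' c'" | u where "bp x y z = u *\<^sub>R bp a b c + (1 - u) *\<^sub>R bp a' b' c'"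
    unfolding collinear_3_expand by blast
  then show ?thesis
  proof cases
    \<comment> \<open>Two of the points coincide: two rows of the determinant are proportional.\<close>
    case 1
    define s s' where "s = a + b + c" and "s' = a' + b' + c'"
    have "a * s' = a' * s" "b * s' = b' * s" "c * s' = c' * s" "s \<noteq> 0"
      using bp_inject[OF 1] assms by (simp_all add: s_def s'_def)
    then have "a' = a * (s'/s)" "b' = b * (s'/s)" "c' = c * (s'/s)" by (simp_all add: field_simps)
    then show ?thesis by algebra
  next
    case 2
    then have "hom (bp x y z) = u *\<^sub>R hom (bp a b c) + (1 - u) *\<^sub>R hom (bp a' b' c')"
      by (simp add: hom_def)
    then have "hvec (x / (x+y+z)) (y / (x+y+z)) (z / (x+y+z)) \<in> join (bary A B C a b c) (bary A B C a' b' c')"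
      unfolding hom_bp[OF assms(2)] hom_bp[OF assms(3)] hom_bp[OF assms(4)]
      unfolding hvec_scaleR hvec_add hvec_inject mem_join_iff
      by (intro exI[of _ "u / (a+b+c)"] exI[of _ "(1-u) / (a'+b'+c')"]) simp
    from mem_joinD[OF this] show ?thesis using assms(2) by (simp add: divide_simps)
  qed
qed

section \<open>Affine maps in coordinates\<close>

text \<open>
  The linear map that induces \<open>ext_map f\<close> when \<open>f\<close> is affine.
\<close>

definition ext_lin :: "(plane \<Rightarrow> plane) \<Rightarrow> homog \<Rightarrow> homog" where
  "ext_lin f = (\<lambda>(v, t). (f v - f 0 + t *\<^sub>R f 0, t))"

lemma ext_lin_linear: "affine_map f \<Longrightarrow> linear (ext_lin f)"
proof -
  assume "affine_map f"
  then obtain L c where L: "linear L" and f: "f = (\<lambda>x. L x + c)" by (auto simp: affine_map_def)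
  have "ext_lin f = (\<lambda>p. (L (fst p) + snd p *\<^sub>R c, snd p))"
    by (auto simp: ext_lin_def f linear_0[OF L])
  then show ?thesis
    by (intro linearI) (simp_all add: linear_add[OF L] linear_scale[OF L] scaleR_add_left scaleR_add_right)
qed

lemma ext_lin_hom: "affine_map f \<Longrightarrow> ext_lin f (hom X) = hom (f X)"
  by (auto simp: affine_map_def ext_lin_def hom_def)

lemma ext_map_span: "affine_map f \<Longrightarrow> ext_map f (span S) = span (ext_lin f ` S)"
  by (simp add: ext_map_def real_vector.linear_span_image ext_lin_linear ext_lin_def[symmetric])

lemma ext_map_pt: "affine_map f \<Longrightarrow> ext_map f (pt X) = pt (f X)"
  by (simp add: pt_def ext_map_span ext_lin_hom)

lemma affine_map_bp:
  assumes "affine_map f" "x + y + z \<noteq> 0"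
  shows "f (bp x y z) = (1 / (x + y + z)) *\<^sub>R (x *\<^sub>R f A + y *\<^sub>R f B + z *\<^sub>R f C)"
proof -
  have "hom (f (bp x y z)) = (1 / (x + y + z)) *\<^sub>R ext_lin f (hvec x y z)"
    using assms by (simp add: linear_scale[OF ext_lin_linear] hom_bp flip: ext_lin_hom)
  also have "ext_lin f (hvec x y z) = x *\<^sub>R hom (f A) + y *\<^sub>R hom (f B) + z *\<^sub>R hom (f C)"
    using assms(1) by (simp add: hvec_def linear_add linear_scale ext_lin_linear ext_lin_hom)
  finally show ?thesis by (simp add: hom_def)
qed

text \<open>
  An affine map commutes with barycentric combinations, so its values at the vertices of a triangle
  determine it.
\<close>

lemma affine_map_ext:
  assumes "affine_map f" "affine_map g" "f A = g A" "f B = g B" "f C = g C"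
  shows "f = g"
proof
  fix X
  obtain x y z where "X = bp x y z" "x + y + z = 1" by (rule bp_surj)
  then show "f X = g X"
    by (simp only: affine_map_bp[OF assms(1)] affine_map_bp[OF assms(2)] assms(3-) one_neq_zero not_False_eq_True)
qed

lemma affine_map_exists:
  obtains f where "affine_map f" "f A = D" "f B = E" "f C = F"
proof -
  have "C - A \<noteq> 0" using non_collinear by (auto simp: insert_commute)
  moreover have "B - A \<notin> span {C - A}"
  proof
    assume "B - A \<in> span {C - A}"
    then obtain k where "B - A = k *\<^sub>R (C - A)" by (auto simp: span_singleton)
    then have "hvec (k - 1) 1 (-k) = 0"
      by (simp add: hvec_def hom_def zero_prod_def algebra_simps)
    then show False by (simp add: hvec_eq_0_iff)
  qed
  ultimately have ind: "independent {B - A, C - A}" "B - A \<noteq> C - A"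
    by (auto simp: independent_insert span_base)
  obtain L where L: "linear L" "L (B - A) = E - D" "L (C - A) = F - D"
    using linear_independent_extend[OF ind(1), of "\<lambda>x. if x = B - A then E - D else F - D"] ind(2)
    by auto
  show ?thesis
  proof
    show "affine_map (\<lambda>x. L x + (D - L A))" unfolding affine_map_def using L(1) by blast
    show "L A + (D - L A) = D" by simp
    show "L B + (D - L A) = E" using L(2) linear_diff[OF L(1), of B A] by (simp add: algebra_simps)
    show "L C + (D - L A) = F" using L(3) linear_diff[OF L(1), of C A] by (simp add: algebra_simps)
  qed
qed

lemma affine_map_comp: "affine_map f \<Longrightarrow> affine_map g \<Longrightarrow> affine_map (f \<circ> g)"
  unfolding affine_map_def
proof (elim exE conjE)
  fix L c L' c'
  assume *: "linear L" "f = (\<lambda>x. L x + c)" "linear L'" "g = (\<lambda>x. L' x + c')"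
  then have "f \<circ> g = (\<lambda>x. (L \<circ> L') x + (L c' + c))" by (auto simp: linear_add)
  then show "\<exists>L c. linear L \<and> f \<circ> g = (\<lambda>x. L x + c)"
    using linear_compose[of L' L] * by blast
qed

text \<open>
  For \<open>f x = L x + c\<close>, the inverse satisfies \<open>L (g x - g 0) = x\<close>; injectivity of \<open>L\<close> transfers
  linearity from \<open>x\<close> to \<open>g x - g 0\<close>.
\<close>

lemma affine_map_inverse:
  assumes "affine_map f" "\<And>x. f (g x) = x" "\<And>x. g (f x) = x"
  shows "affine_map g"
proof -
  obtain L c where L: "linear L" and f: "\<And>x. f x = L x + c" using assms(1) by (auto simp: affine_map_def)
  have inj: "x = y" if "L x = L y" for x y using that f assms(3) by metis
  have "L (g x - g 0) = f (g x) - f (g 0)" for x by (simp add: linear_diff[OF L] f)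
  then have Lg: "L (g x - g 0) = x" for x by (simp add: assms(2))
  have "linear (\<lambda>x. g x - g 0)"
    by (rule linearI; rule inj) (simp_all only: Lg linear_add[OF L] linear_scale[OF L])
  then show ?thesis unfolding affine_map_def by (intro exI[of _ "\<lambda>x. g x - g 0"] exI[of _ "g 0"]) simp
qed

text \<open>
  The linear part is injective as well, and injective endomorphisms of a finite-dimensional space are
  surjective.
\<close>

lemma affine_map_inj_imp_bij:
  assumes "affine_map f" "inj f"
  shows "bij f"
proof -
  obtain L c where L: "linear L" and f: "f = (\<lambda>x. L x + c)" using assms(1) by (auto simp: affine_map_def)
  have "inj L" using assms(2) by (auto simp: f inj_def)
  then have "surj L" using L linear_injective_imp_surjective by blast
  have "surj f" unfolding f
  proof (rule surjI)
    show "L (inv L (y - c)) + c = y" for y using \<open>surj L\<close> by (simp add: surj_f_inv_f)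
  qed
  then show ?thesis using assms(2) by (simp add: bij_def)
qed

lemma affine_map_inv: "affine_map f \<Longrightarrow> bij f \<Longrightarrow> affine_map (inv f)"
  by (rule affine_map_inverse) (auto simp: bij_is_surj surj_f_inv_f bij_is_inj inv_f_f)

lemma ext_map_inv:
  assumes "affine_map f" "bij f"
  shows "ext_map f (ext_map (inv f) p) = p" "ext_map (inv f) (ext_map f p) = p"
proof -
  have lin: "linear (ext_lin f)" "linear (ext_lin (inv f))"
    using assms by (simp_all add: ext_lin_linear affine_map_inv)
  have "ext_lin f (ext_lin (inv f) v) = v \<and> ext_lin (inv f) (ext_lin f v) = v" for v
  proof -
    obtain x y z where "v = hvec x y z" by (rule hvec_surj)
    then show ?thesis
      using assms lin
      by (simp add: hvec_def linear_add linear_scale ext_lin_hom affine_map_inv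
            bij_is_surj surj_f_inv_f bij_is_inj inv_f_f)
  qed
  then show "ext_map f (ext_map (inv f) p) = p" "ext_map (inv f) (ext_map f p) = p"
    by (simp_all add: ext_map_def image_image flip: ext_lin_def)
qed

lemma affine_hull_homE:
  assumes "X \<in> affine hull {Y, W}"
  obtains u v where "hom X = u *\<^sub>R hom Y + v *\<^sub>R hom W"
  using assms by (auto simp: affine_hull_2 hom_def)

lemma complement_map_eq: "complement_map A B C = (\<lambda>X. (1/2) *\<^sub>R (A + B + C - X))"
  by (rule ext) (simp add: complement_map_def centroid_def vec_eq_iff field_simps)

lemma inv_complement_map: "inv (complement_map A B C) = (\<lambda>X. A + B + C - 2 *\<^sub>R X)"
  by (rule inv_equality) (simp_all add: complement_map_eq algebra_simps)

lemma affine_complement_map: "affine_map (complement_map A B C)"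
  unfolding affine_map_def complement_map_eq
  by (intro exI[of _ "\<lambda>X. (-1/2) *\<^sub>R X"] exI[of _ "(1/2) *\<^sub>R (A + B + C)"])
    (auto simp: linear_iff algebra_simps)

lemma affine_inv_complement_map: "affine_map (inv (complement_map A B C))"
  unfolding affine_map_def inv_complement_map
  by (intro exI[of _ "\<lambda>X. (-2) *\<^sub>R X"] exI[of _ "A + B + C"])
    (auto simp: linear_iff algebra_simps)

lemma ext_lin_complement_map:
  "ext_lin (complement_map A B C) (hvec x y z) = (1/2) *\<^sub>R hvec (y + z) (z + x) (x + y)"
proof -
  have *: "hom (complement_map A B C X) = (1/2) *\<^sub>R (hom A + hom B + hom C - hom X)" for X
    by (simp add: complement_map_eq hom_def)
  show ?thesis
    unfolding hvec_def linear_add[OF ext_lin_linear[OF affine_complement_map]]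
      linear_scale[OF ext_lin_linear[OF affine_complement_map]] ext_lin_hom[OF affine_complement_map] *
    by (simp add: algebra_simps)
qed

lemma ext_lin_inv_complement_map:
  "ext_lin (inv (complement_map A B C)) (hvec x y z) = hvec (y + z - x) (z + x - y) (x + y - z)"
proof -
  have *: "hom (inv (complement_map A B C) X) = hom A + hom B + hom C - 2 *\<^sub>R hom X" for X
    by (simp add: inv_complement_map hom_def)
  show ?thesis
    unfolding hvec_def linear_add[OF ext_lin_linear[OF affine_inv_complement_map]]
      linear_scale[OF ext_lin_linear[OF affine_inv_complement_map]] ext_lin_hom[OF affine_inv_complement_map] *
    by (simp add: algebra_simps scaleR_2)
qed

lemma complement_map_bp:
  assumes "x + y + z \<noteq> 0"
  shows "complement_map A B C (bp x y z) = bp (y + z) (z + x) (x + y)"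
proof -
  have s: "y + z + (z + x) + (x + y) = (x + y + z) * 2" by simp
  have "hom (complement_map A B C (bp x y z)) = hom (bp (y + z) (z + x) (x + y))"
    using assms unfolding ext_lin_hom[OF affine_complement_map, symmetric]
    by (simp add: s hom_bp linear_scale ext_lin_linear affine_complement_map ext_lin_complement_map)
  then show ?thesis by (simp add: hom_def)
qed

lemma inv_complement_map_bp:
  assumes "x + y + z \<noteq> 0"
  shows "inv (complement_map A B C) (bp x y z) = bp (y + z - x) (z + x - y) (x + y - z)"
proof -
  have s: "y + z - x + (z + x - y) + (x + y - z) = x + y + z" by simp
  have "hom (inv (complement_map A B C) (bp x y z)) = hom (bp (y + z - x) (z + x - y) (x + y - z))"
    using assms unfolding ext_lin_hom[OF affine_inv_complement_map, symmetric]
    by (simp add: s hom_bp linear_scale ext_lin_linear affine_inv_complement_map ext_lin_inv_complement_map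
        del: add_diff_cancel)
  then show ?thesis by (simp add: hom_def)
qed

lemma ext_complement_map_bary:
  "ext_map (complement_map A B C) (bary A B C x y z) = bary A B C (y + z) (z + x) (x + y)"
  by (simp add: bary_hvec ext_map_span affine_complement_map span_scaleR ext_lin_complement_map)

lemma ext_inv_complement_map_bary:
  "ext_map (inv (complement_map A B C)) (bary A B C x y z) = bary A B C (y + z - x) (z + x - y) (x + y - z)"
  by (simp add: bary_hvec ext_map_span affine_inv_complement_map ext_lin_inv_complement_map)

text \<open>
  Projecting from \<open>A\<close> onto \<open>BC\<close> deletes the first coordinate.  The condition \<open>p \<noteq> 0\<close> makes the
  intersection a single point, and \<open>q + r \<noteq> 0\<close> makes it ordinary.
\<close>

lemma cevian_trace_bp:
  assumes "p \<noteq> 0" "q + r \<noteq> 0" "p + q + r \<noteq> 0"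
  shows "cevian_trace A B C (bp p q r) = bp 0 q r"
proof -
  have "affine hull {A, bp p q r} \<inter> affine hull {B, C} = {bp 0 q r}"
  proof (intro equalityI subsetI)
    fix Y assume Y: "Y \<in> affine hull {A, bp p q r} \<inter> affine hull {B, C}"
    obtain u v where 1: "hom Y = u *\<^sub>R hom A + v *\<^sub>R hom (bp p q r)"
      using Y by (blast elim: affine_hull_homE)
    obtain s t where 2: "hom Y = s *\<^sub>R hom B + t *\<^sub>R hom C"
      using Y by (blast elim: affine_hull_homE)
    define w where "w = v / (p + q + r)"
    have "hom Y = hvec (u + w * p) (w * q) (w * r)"
      unfolding 1 w_def using assms(3) by (simp add: hom_bp hvec_def algebra_simps)
    moreover have "hom Y = hvec 0 s t"
      unfolding 2 by (simp add: hvec_def)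
    ultimately have Yw: "hom Y = w *\<^sub>R hvec 0 q r" by (simp add: hvec_inject hvec_scaleR)
    have "w * (q + r) = 1"
      using arg_cong[OF Yw, of snd] by (simp add: hom_def hvec_components)
    then have "hom Y = hom (bp 0 q r)"
      using assms(2) by (simp add: Yw hom_bp divide_simps)
    then show "Y \<in> {bp 0 q r}" by (simp add: hom_def)
  next
    fix Y assume "Y \<in> {bp 0 q r}"
    then have Y: "Y = bp 0 q r" by simp
    have "Y = (- p / (q + r)) *\<^sub>R A + ((p + q + r) / (q + r)) *\<^sub>R bp p q r"
      using assms unfolding Y bary_point_def by (simp add: vec_eq_iff divide_simps)
    moreover have "- p / (q + r) + (p + q + r) / (q + r) = 1" using assms by (simp add: add_divide_distrib[symmetric] flip: diff_divide_distrib)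
    moreover have "Y = (q / (q + r)) *\<^sub>R B + (r / (q + r)) *\<^sub>R C"
      unfolding Y bary_point_def by (simp add: algebra_simps)
    moreover have "q / (q + r) + r / (q + r) = 1" using assms by (simp flip: add_divide_distrib)
    ultimately show "Y \<in> affine hull {A, bp p q r} \<inter> affine hull {B, C}"
      unfolding affine_hull_2 by blast
  qed
  then show ?thesis by (simp add: cevian_trace_def)
qed

end

text \<open>
  The traces on the other two sides are the same statement for the cyclically renamed triangle.
\<close>

lemma (in triangle) rotated: "triangle B C A" "triangle C A B"
  using non_collinear by (simp_all add: triangle_def insert_commute)

context triangle
begin

lemma cevian_map_vertices:
  assumes "p \<noteq> 0" "q \<noteq> 0" "r \<noteq> 0" "q + r \<noteq> 0" "r + p \<noteq> 0" "p + q \<noteq> 0" "p + q + r \<noteq> 0"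
  defines "T \<equiv> cevian_map A B C (bp p q r)"
  shows "affine_map T" "T A = bp 0 q r" "T B = bp p 0 r" "T C = bp p q 0"
proof -
  have traces: "cevian_trace A B C (bp p q r) = bp 0 q r" "cevian_trace B C A (bp p q r) = bp p 0 r"
    "cevian_trace C A B (bp p q r) = bp p q 0"
    using cevian_trace_bp[of p q r] triangle.cevian_trace_bp[OF rotated(1), of q r p]
      triangle.cevian_trace_bp[OF rotated(2), of r p q] assms(1-7)
    by (simp_all add: bary_point_rotate add_ac)
  obtain f where f: "affine_map f" "f A = bp 0 q r" "f B = bp p 0 r" "f C = bp p q 0"
    by (rule affine_map_exists)
  have "T = f" unfolding T_def cevian_map_def traces
    by (rule the_equality) (use f affine_map_ext in auto)
  then show "affine_map T" "T A = bp 0 q r" "T B = bp p 0 r" "T C = bp p q 0" using f by auto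
qed

lemma cevian_map_bp:
  assumes nz: "p \<noteq> 0" "q \<noteq> 0" "r \<noteq> 0" "q + r \<noteq> 0" "r + p \<noteq> 0" "p + q \<noteq> 0" "p + q + r \<noteq> 0"
    and xyz: "x + y + z \<noteq> 0"
  shows "cevian_map A B C (bp p q r) (bp x y z) =
    bp (p * (q + r) * (y * (p + q) + z * (r + p)))
       (q * (r + p) * (z * (q + r) + x * (p + q)))
       (r * (p + q) * (x * (r + p) + y * (q + r)))" (is "?T (bp x y z) = bp ?a ?b ?c")
proof -
  have sum: "?a + ?b + ?c = (q + r) * (r + p) * (p + q) * (x + y + z)" by algebra
  have "hom (?T (bp x y z)) =
      (1 / (x + y + z)) *\<^sub>R (x *\<^sub>R hom (bp 0 q r) + y *\<^sub>R hom (bp p 0 r) + z *\<^sub>R hom (bp p q 0))"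
    unfolding affine_map_bp[OF cevian_map_vertices(1)[OF nz] xyz] cevian_map_vertices[OF nz]
    using xyz by (simp add: hom_def flip: add_divide_distrib)
  also have "\<dots> = (1 / ((q + r) * (r + p) * (p + q) * (x + y + z))) *\<^sub>R hvec ?a ?b ?c"
    using nz xyz by (simp add: hom_bp hvec_scaleR hvec_add hvec_inject divide_simps) algebra
  also have "\<dots> = hom (bp ?a ?b ?c)" using nz xyz sum by (simp add: hom_bp)
  finally show ?thesis by (simp add: hom_def)
qed

text \<open>
  In coordinates the linear part is a matrix of determinant \<open>2pqr/k\<close> with
  \<open>k = (q + r)(r + p)(p + q)\<close>; after scaling, adding two of the three homogeneous equations
  and subtracting the third isolates each unknown.
\<close>

lemma cevian_map_bij:
  assumes nz: "p \<noteq> 0" "q \<noteq> 0" "r \<noteq> 0" "q + r \<noteq> 0" "r + p \<noteq> 0" "p + q \<noteq> 0" "p + q + r \<noteq> 0"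
  shows "bij (cevian_map A B C (bp p q r))" (is "bij ?T")
proof (rule affine_map_inj_imp_bij[OF cevian_map_vertices(1)[OF nz]], rule injI)
  fix X Y assume eq: "?T X = ?T Y"
  obtain x y z where X: "X = bp x y z" "x + y + z = 1" by (rule bp_surj)
  obtain x' y' z' where Y: "Y = bp x' y' z'" "x' + y' + z' = 1" by (rule bp_surj)
  let ?k = "(q + r) * (r + p) * (p + q)"
  have k: "p * (q + r) * (v * (p + q) + w * (r + p)) + q * (r + p) * (w * (q + r) + u * (p + q))
      + r * (p + q) * (u * (r + p) + v * (q + r)) = ?k" if "u + v + w = 1" for u v w
    using that by algebra
  have k0: "?k \<noteq> 0" using nz by simp
  have T: "?T X = bp (p * (q + r) * (y * (p + q) + z * (r + p)))
       (q * (r + p) * (z * (q + r) + x * (p + q))) (r * (p + q) * (x * (r + p) + y * (q + r)))"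
    "?T Y = bp (p * (q + r) * (y' * (p + q) + z' * (r + p)))
       (q * (r + p) * (z' * (q + r) + x' * (p + q))) (r * (p + q) * (x' * (r + p) + y' * (q + r)))"
    unfolding X(1) Y(1) by (rule cevian_map_bp[OF nz]; use X Y in simp)+
  define dx dy dz where d: "dx = x - x'" "dy = y - y'" "dz = z - z'"
  have "y * (p + q) + z * (r + p) = y' * (p + q) + z' * (r + p)"
    "z * (q + r) + x * (p + q) = z' * (q + r) + x' * (p + q)"
    "x * (r + p) + y * (q + r) = x' * (r + p) + y' * (q + r)"
    using bp_inject[OF eq[unfolded T]] nz k0 unfolding k[OF X(2)] k[OF Y(2)] by auto
  then have "dy * (p + q) + dz * (r + p) = 0" "dz * (q + r) + dx * (p + q) = 0" "dx * (r + p) + dy * (q + r) = 0"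
    unfolding d by algebra+
  then have "2 * (dx * (r + p) * (p + q)) = 0" "2 * (dy * (p + q) * (q + r)) = 0" "2 * (dz * (q + r) * (r + p)) = 0"
    by algebra+
  then have "dx = 0" "dy = 0" "dz = 0" using nz by auto
  then show "X = Y" unfolding X Y d by simp
qed

section \<open>Conics in coordinates\<close>

text \<open>
  The symmetric bilinear form of the quadratic form
  \<open>ax\<^sup>2 + by\<^sup>2 + cz\<^sup>2 + 2dyz + 2ezx + 2fxy\<close>.  Since the coordinates of a vector are unique, the definite
  description yields the expected value, and no coordinate functionals have to be named.
\<close>

definition qform :: "real \<Rightarrow> real \<Rightarrow> real \<Rightarrow> real \<Rightarrow> real \<Rightarrow> real \<Rightarrow> homog \<Rightarrow> homog \<Rightarrow> real" where
  "qform a b c d e f u v = (THE t. \<exists>x y z x' y' z'. u = hvec x y z \<and> v = hvec x' y' z' \<and>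
     t = a * x * x' + b * y * y' + c * z * z'
         + d * (y * z' + z * y') + e * (z * x' + x * z') + f * (x * y' + y * x'))"

lemma qform_hvec:
  "qform a b c d e f (hvec x y z) (hvec x' y' z') =
    a * x * x' + b * y * y' + c * z * z'
    + d * (y * z' + z * y') + e * (z * x' + x * z') + f * (x * y' + y * x')"
  unfolding qform_def by (rule the_equality) (auto simp: hvec_inject)

lemma qform_scale: "qform (k * a) (k * b) (k * c) (k * d) (k * e) (k * f) u v = k * qform a b c d e f u v"
proof -
  obtain x y z where u: "u = hvec x y z" by (rule hvec_surj)
  obtain x' y' z' where v: "v = hvec x' y' z'" by (rule hvec_surj)
  show ?thesis unfolding u v qform_hvec by algebra
qed

lemma bilinear_qform: "bilinear (qform a b c d e f)"
  unfolding bilinear_def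
proof (intro conjI allI linearI)
  fix u v w :: homog and k :: real
  obtain x y z where u: "u = hvec x y z" by (rule hvec_surj)
  obtain x' y' z' where v: "v = hvec x' y' z'" by (rule hvec_surj)
  obtain x'' y'' z'' where w: "w = hvec x'' y'' z''" by (rule hvec_surj)
  show "qform a b c d e f u (v + w) = qform a b c d e f u v + qform a b c d e f u w"
    "qform a b c d e f (v + w) u = qform a b c d e f v u + qform a b c d e f w u"
    "qform a b c d e f u (k *\<^sub>R v) = k *\<^sub>R qform a b c d e f u v"
    "qform a b c d e f (k *\<^sub>R v) u = k *\<^sub>R qform a b c d e f v u"
    unfolding u v w hvec_add hvec_scaleR qform_hvec real_scaleR_def by algebra+
qed

text \<open>
  Multiplication by the adjugate matrix turns the three equations of a vector in the radical into
  \<open>det * x = 0\<close>, \<open>det * y = 0\<close>, \<open>det * z = 0\<close>.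
\<close>

lemma conic_form_qform:
  assumes det: "a * b * c + 2 * d * e * f - a * d\<^sup>2 - b * e\<^sup>2 - c * f\<^sup>2 \<noteq> 0"
  shows "conic_form (qform a b c d e f)"
  unfolding conic_form_def
proof (intro conjI allI impI bilinear_qform)
  fix u v
  obtain x y z where u: "u = hvec x y z" by (rule hvec_surj)
  obtain x' y' z' where v: "v = hvec x' y' z'" by (rule hvec_surj)
  show "qform a b c d e f u v = qform a b c d e f v u" unfolding u v qform_hvec by algebra
next
  fix u assume deg: "\<forall>v. qform a b c d e f u v = 0"
  obtain x y z where u: "u = hvec x y z" by (rule hvec_surj)
  let ?D = "a * b * c + 2 * d * e * f - a * d\<^sup>2 - b * e\<^sup>2 - c * f\<^sup>2"
  have "a * x + f * y + e * z = 0" "f * x + b * y + d * z = 0" "e * x + d * y + c * z = 0"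
    using deg[rule_format, of "hvec 1 0 0"] deg[rule_format, of "hvec 0 1 0"]
      deg[rule_format, of "hvec 0 0 1"] unfolding u qform_hvec by simp_all
  then have "?D * x = 0" "?D * y = 0" "?D * z = 0" by algebra+
  then show "u = 0" using det unfolding u by (simp add: hvec_eq_0_iff)
qed

lemma conic_form_is_qform:
  assumes "conic_form \<beta>"
  obtains a b c d e f where "\<beta> = qform a b c d e f"
proof -
  have bil: "bilinear \<beta>" and sym: "\<beta> u v = \<beta> v u" for u v
    using assms unfolding conic_form_def by blast+
  let ?A = "hom A" and ?B = "hom B" and ?C = "hom C"
  have "\<beta> u v = qform (\<beta> ?A ?A) (\<beta> ?B ?B) (\<beta> ?C ?C) (\<beta> ?B ?C) (\<beta> ?C ?A) (\<beta> ?A ?B) u v" for u v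
  proof -
    obtain x y z where u: "u = hvec x y z" by (rule hvec_surj)
    obtain x' y' z' where v: "v = hvec x' y' z'" by (rule hvec_surj)
    have "\<beta> (hvec x y z) (hvec x' y' z') =
        x * x' * \<beta> ?A ?A + x * y' * \<beta> ?A ?B + x * z' * \<beta> ?C ?A +
        (y * x' * \<beta> ?A ?B + y * y' * \<beta> ?B ?B + y * z' * \<beta> ?B ?C) +
        (z * x' * \<beta> ?C ?A + z * y' * \<beta> ?B ?C + z * z' * \<beta> ?C ?C)"
      unfolding hvec_def
      by (simp only: bilinear_ladd[OF bil] bilinear_radd[OF bil] bilinear_lmul[OF bil]
          bilinear_rmul[OF bil] real_scaleR_def sym[of ?B ?A] sym[of ?A ?C] sym[of ?C ?B])
        (simp add: distrib_left mult.assoc)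
    then show ?thesis unfolding u v qform_hvec by algebra
  qed
  then show ?thesis by (intro that ext)
qed

lemma bary_mem_conic_of_iff:
  "bary A B C x y z \<in> conic_of (qform a b c d e f) \<longleftrightarrow>
    (x \<noteq> 0 \<or> y \<noteq> 0 \<or> z \<noteq> 0) \<and>
    a * x\<^sup>2 + b * y\<^sup>2 + c * z\<^sup>2 + 2 * d * y * z + 2 * e * z * x + 2 * f * x * y = 0" (is "_ \<longleftrightarrow> _ \<and> ?q = 0")
proof -
  have "ext_point (bary A B C x y z) \<longleftrightarrow> x \<noteq> 0 \<or> y \<noteq> 0 \<or> z \<noteq> 0"
    by (simp add: ext_point_def bary_hvec hvec_eq_0_iff)
  moreover have "(\<forall>v\<in>bary A B C x y z. qform a b c d e f v v = 0) \<longleftrightarrow> ?q = 0"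
  proof -
    have *: "qform a b c d e f (k *\<^sub>R hvec x y z) (k *\<^sub>R hvec x y z) = k\<^sup>2 * ?q" for k
      unfolding hvec_scaleR qform_hvec by algebra
    show ?thesis
      unfolding bary_hvec span_singleton using * by (auto dest: spec[of _ 1])
  qed
  ultimately show ?thesis by (simp add: conic_of_def)
qed

text \<open>
  If the conditions of passing through \<open>X\<close> determine the six coefficients up to a common factor,
  then every nondegenerate form whose conic contains \<open>X\<close> is a nonzero multiple of the given one, the
  factor \<open>0\<close> being excluded by nondegeneracy.  Such forms have the same zeros and the same polars, so
  the conic through \<open>X\<close> and its poles are well defined and can be computed from the given form.
\<close>

lemma conic_through_qform:
  assumes det: "a * b * c + 2 * d * e * f - a * d\<^sup>2 - b * e\<^sup>2 - c * f\<^sup>2 \<noteq> 0"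
    and X: "X \<noteq> {}" "X \<subseteq> conic_of (qform a b c d e f)"
    and unique: "\<And>a' b' c' d' e' f'. X \<subseteq> conic_of (qform a' b' c' d' e' f') \<Longrightarrow>
      \<exists>k. a' = k * a \<and> b' = k * b \<and> c' = k * c \<and> d' = k * d \<and> e' = k * e \<and> f' = k * f"
  shows "conic_through X = conic_of (qform a b c d e f)"
    and "pole (conic_through X) l = {u. \<forall>v\<in>l. qform a b c d e f u v = 0}"
proof -
  let ?q = "qform a b c d e f"
  have q: "conic_form ?q" using det by (rule conic_form_qform)
  have proportional: "\<exists>k. k \<noteq> 0 \<and> \<beta> = (\<lambda>u v. k * ?q u v)" if \<beta>: "conic_form \<beta>" "X \<subseteq> conic_of \<beta>" for \<beta>
  proof -
    obtain a' b' c' d' e' f' where 1: "\<beta> = qform a' b' c' d' e' f'"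
      using conic_form_is_qform \<beta>(1) by blast
    then obtain k where "\<beta> = qform (k * a) (k * b) (k * c) (k * d) (k * e) (k * f)"
      using unique \<beta>(2) by blast
    then have k: "\<beta> = (\<lambda>u v. k * ?q u v)" by (simp add: fun_eq_iff qform_scale)
    have "k \<noteq> 0"
    proof
      assume "k = 0"
      then have "\<beta> (hvec 1 0 0) v = 0" for v by (simp add: k)
      then have "hvec 1 0 0 = 0" using \<beta>(1) unfolding conic_form_def by blast
      then show False by (simp add: hvec_eq_0_iff)
    qed
    then show ?thesis using k by blast
  qed
  have same: "conic_of \<beta> = conic_of ?q" if "k \<noteq> 0" "\<beta> = (\<lambda>u v. k * ?q u v)" for \<beta> k
    using that by (simp add: conic_of_def)
  show eq: "conic_through X = conic_of ?q"
    unfolding conic_through_def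
  proof (rule the_equality)
    show "is_conic (conic_of ?q) \<and> X \<subseteq> conic_of ?q" using X q unfolding is_conic_def by blast
    show "S = conic_of ?q" if "is_conic S \<and> X \<subseteq> S" for S
      using that proportional same unfolding is_conic_def by metis
  qed
  show "pole (conic_through X) l = {u. \<forall>v\<in>l. ?q u v = 0}"
    unfolding eq pole_def
  proof (rule the_equality)
    show "\<exists>b'. conic_form b' \<and> conic_of ?q = conic_of b' \<and>
        {u. \<forall>v\<in>l. ?q u v = 0} = {u. \<forall>v\<in>l. b' u v = 0}" using q by blast
    fix p assume "\<exists>\<beta>. conic_form \<beta> \<and> conic_of ?q = conic_of \<beta> \<and> p = {u. \<forall>v\<in>l. \<beta> u v = 0}"
    then obtain \<beta> where \<beta>: "conic_form \<beta>" "conic_of ?q = conic_of \<beta>" and p: "p = {u. \<forall>v\<in>l. \<beta> u v = 0}"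
      by blast
    obtain k where "k \<noteq> 0" "\<beta> = (\<lambda>u v. k * ?q u v)" using proportional[OF \<beta>(1)] \<beta>(2) X(2) by blast
    then show "p = {u. \<forall>v\<in>l. ?q u v = 0}" unfolding p by simp
  qed
qed

lemma line_infinity_hvec: "hvec x y z \<in> line_infinity \<longleftrightarrow> x + y + z = 0"
  using hvec_components(2)[of x y z] by (auto simp: line_infinity_def split_beta)

end

section \<open>The configuration of a point and its isotomic conjugate\<close>

text \<open>
  The coordinates \<open>(p : q : r)\<close> of a point off the sides of \<open>ABC\<close> (\<open>p\<close>, \<open>q\<close>, \<open>r\<close> nonzero), off
  the sides of the anticomplementary triangle (\<open>q + r\<close>, \<open>r + p\<close>, \<open>p + q\<close> nonzero) and off the
  medians (\<open>p\<close>, \<open>q\<close>, \<open>r\<close> distinct), such that the point and its isotomic conjugate are ordinary.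
\<close>

locale cevian_point = triangle +
  fixes p q r :: real
  assumes nonzero: "p \<noteq> 0" "q \<noteq> 0" "r \<noteq> 0" "q + r \<noteq> 0" "r + p \<noteq> 0" "p + q \<noteq> 0" "p + q + r \<noteq> 0"
    and isotomic_sum: "p * q + q * r + r * p \<noteq> 0"
    and distinct: "p \<noteq> q" "q \<noteq> r" "r \<noteq> p"
begin

abbreviation K :: "plane \<Rightarrow> plane" where "K \<equiv> complement_map A B C"

definition P :: plane where "P = bp p q r"
definition "P' = bp (q * r) (r * p) (p * q)"
definition "T\<^sub>P = cevian_map A B C P"
definition "T\<^sub>P' = cevian_map A B C P'"
definition "Q = K P'"
definition "Q' = K P"

text \<open>
  The equation of the curve of all \<open>P\<close> for which \<open>M\<close> is a translation.
\<close>

definition cubic :: real where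
  "cubic = p\<^sup>2 * (q + r) + q\<^sup>2 * (r + p) + r\<^sup>2 * (p + q) + 6 * p * q * r"

text \<open>
  The coordinates of \<open>P'\<close> satisfy the same conditions as those of \<open>P\<close>, because
  \<open>rp + pq = p(q + r)\<close>; facts about cevian maps therefore apply to both points.
\<close>

lemma P'_nonzero: "q * r \<noteq> 0" "r * p \<noteq> 0" "p * q \<noteq> 0" "r * p + p * q \<noteq> 0" "p * q + q * r \<noteq> 0" "q * r + r * p \<noteq> 0"
    "q * r + r * p + p * q \<noteq> 0"
proof -
  have "r * p + p * q = p * (q + r)" "p * q + q * r = q * (r + p)" "q * r + r * p = r * (p + q)"
    by algebra+
  then show "q * r \<noteq> 0" "r * p \<noteq> 0" "p * q \<noteq> 0" "r * p + p * q \<noteq> 0" "p * q + q * r \<noteq> 0" "q * r + r * p \<noteq> 0"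
    using nonzero by simp_all
  show "q * r + r * p + p * q \<noteq> 0" using isotomic_sum by (simp add: add_ac)
qed

lemma Q_bp: "Q = bp (p * (q + r)) (q * (r + p)) (r * (p + q))"
  unfolding Q_def P'_def complement_map_bp[OF P'_nonzero(7)]
  by (rule bary_point_cong[of _ 1]) (simp_all add: algebra_simps)

lemma Q'_bp: "Q' = bp (q + r) (r + p) (p + q)"
  unfolding Q'_def P_def by (rule complement_map_bp[OF nonzero(7)])

lemma Q_sum: "p * (q + r) + q * (r + p) + r * (p + q) = 2 * (p * q + q * r + r * p)" by algebra
lemma Q'_sum: "q + r + (r + p) + (p + q) = 2 * (p + q + r)" by algebra

lemma pt_P: "pt P = bary A B C p q r"
  unfolding P_def by (rule pt_bp[OF nonzero(7)])

lemma pt_P': "pt P' = bary A B C (q * r) (r * p) (p * q)"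
  unfolding P'_def by (rule pt_bp[OF P'_nonzero(7)])

lemma pt_Q: "pt Q = bary A B C (p * (q + r)) (q * (r + p)) (r * (p + q))"
  unfolding Q_bp by (rule pt_bp) (simp only: Q_sum, use isotomic_sum in simp)

lemma pt_Q': "pt Q' = bary A B C (q + r) (r + p) (p + q)"
  unfolding Q'_bp by (rule pt_bp) (simp only: Q'_sum, use nonzero(7) in simp)

lemmas T\<^sub>P_vertices = cevian_map_vertices[OF nonzero, folded P_def, folded T\<^sub>P_def]
lemmas T\<^sub>P_bp = cevian_map_bp[OF nonzero, folded P_def, folded T\<^sub>P_def]
lemmas T\<^sub>P_bij = cevian_map_bij[OF nonzero, folded P_def, folded T\<^sub>P_def]
lemmas T\<^sub>P'_affine = cevian_map_vertices(1)[OF P'_nonzero, folded P'_def, folded T\<^sub>P'_def]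
lemmas T\<^sub>P'_bij = cevian_map_bij[OF P'_nonzero, folded P'_def, folded T\<^sub>P'_def]

lemma T\<^sub>P'_bp:
  assumes "x + y + z \<noteq> 0"
  shows "T\<^sub>P' (bp x y z) =
    bp ((q + r) * (y * r * (p + q) + z * q * (r + p)))
       ((r + p) * (z * p * (q + r) + x * r * (p + q)))
       ((p + q) * (x * q * (r + p) + y * p * (q + r)))"
  unfolding cevian_map_bp[OF P'_nonzero assms, folded P'_def, folded T\<^sub>P'_def]
  by (rule bary_point_cong[of _ "p * q * r"]) (use nonzero in \<open>algebra | simp\<close>)+

lemma T\<^sub>P'_vertices: "T\<^sub>P' A = bp 0 r q" "T\<^sub>P' B = bp r 0 p" "T\<^sub>P' C = bp q p 0"
  unfolding cevian_map_vertices[OF P'_nonzero, folded P'_def, folded T\<^sub>P'_def]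
  by (rule bary_point_cong[of _ p] bary_point_cong[of _ q] bary_point_cong[of _ r]; use nonzero in simp)+

subsection \<open>The homothety\<close>

lemma product_eq_cubic: "(q + r) * (r + p) * (p + q) = cubic - 4 * p * q * r"
  unfolding cubic_def by algebra

lemma product_nonzero: "(q + r) * (r + p) * (p + q) \<noteq> 0"
  using nonzero by simp

definition "M = T\<^sub>P \<circ> inv K \<circ> T\<^sub>P'"

lemma M_vertices:
  "M A = bp (p * (q - r)\<^sup>2) (q * (r + p)\<^sup>2) (r * (p + q)\<^sup>2)"
  "M B = bp (p * (q + r)\<^sup>2) (q * (r - p)\<^sup>2) (r * (p + q)\<^sup>2)"
  "M C = bp (p * (q + r)\<^sup>2) (q * (r + p)\<^sup>2) (r * (p - q)\<^sup>2)"
proof -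
  have "M A = T\<^sub>P (bp (r + q) (q - r) (r - q))"
    unfolding M_def comp_def T\<^sub>P'_vertices using nonzero
    by (subst inv_complement_map_bp) (simp_all add: add_ac)
  also have "\<dots> = bp (p * (q - r)\<^sup>2) (q * (r + p)\<^sup>2) (r * (p + q)\<^sup>2)"
    by (rule trans[OF T\<^sub>P_bp bary_point_cong[of _ "q + r"]],
        use nonzero in simp, algebra, algebra, algebra, use nonzero in simp)
  finally show "M A = bp (p * (q - r)\<^sup>2) (q * (r + p)\<^sup>2) (r * (p + q)\<^sup>2)" .
  have "M B = T\<^sub>P (bp (p - r) (p + r) (r - p))"
    unfolding M_def comp_def T\<^sub>P'_vertices using nonzero
    by (subst inv_complement_map_bp) (simp_all add: add_ac)
  also have "\<dots> = bp (p * (q + r)\<^sup>2) (q * (r - p)\<^sup>2) (r * (p + q)\<^sup>2)"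
    by (rule trans[OF T\<^sub>P_bp bary_point_cong[of _ "r + p"]],
        use nonzero in simp, algebra, algebra, algebra, use nonzero in simp)
  finally show "M B = bp (p * (q + r)\<^sup>2) (q * (r - p)\<^sup>2) (r * (p + q)\<^sup>2)" .
  have "M C = T\<^sub>P (bp (p - q) (q - p) (p + q))"
    unfolding M_def comp_def T\<^sub>P'_vertices using nonzero
    by (subst inv_complement_map_bp) (simp_all add: add_ac)
  also have "\<dots> = bp (p * (q + r)\<^sup>2) (q * (r + p)\<^sup>2) (r * (p - q)\<^sup>2)"
    by (rule trans[OF T\<^sub>P_bp bary_point_cong[of _ "p + q"]],
        use nonzero in simp, algebra, algebra, algebra, use nonzero in simp)
  finally show "M C = bp (p * (q + r)\<^sup>2) (q * (r + p)\<^sup>2) (r * (p - q)\<^sup>2)" .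
qed

text \<open>
  In normalized coordinates each of \<open>M A\<close>, \<open>M B\<close>, \<open>M C\<close> differs from the fixed triple
  \<open>(p(q + r)\<^sup>2, q(r + p)\<^sup>2, r(p + q)\<^sup>2) / k\<close> only in the entry of its own vertex, and there by
  \<open>-4pqr/k\<close>, because \<open>(q - r)\<^sup>2 = (q + r)\<^sup>2 - 4qr\<close>.
\<close>

lemma M_homothety:
  obtains t where "\<And>X. M X = (- 4 * p * q * r / ((q + r) * (r + p) * (p + q))) *\<^sub>R X + t"
proof -
  define k where "k = (q + r) * (r + p) * (p + q)"
  define \<rho> where "\<rho> = - 4 * p * q * r / k"
  define t where "t = (1 / k) *\<^sub>R ((p * (q + r)\<^sup>2) *\<^sub>R A + (q * (r + p)\<^sup>2) *\<^sub>R B + (r * (p + q)\<^sup>2) *\<^sub>R C)"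
  have k: "p * (q - r)\<^sup>2 + q * (r + p)\<^sup>2 + r * (p + q)\<^sup>2 = k"
    "p * (q + r)\<^sup>2 + q * (r - p)\<^sup>2 + r * (p + q)\<^sup>2 = k"
    "p * (q + r)\<^sup>2 + q * (r + p)\<^sup>2 + r * (p - q)\<^sup>2 = k"
    unfolding k_def by algebra+
  have sq: "p * (q - r)\<^sup>2 = p * (q + r)\<^sup>2 - 4 * p * q * r" "q * (r - p)\<^sup>2 = q * (r + p)\<^sup>2 - 4 * p * q * r"
    "r * (p - q)\<^sup>2 = r * (p + q)\<^sup>2 - 4 * p * q * r" by algebra+
  have "affine_map M"
    unfolding M_def using T\<^sub>P_vertices(1) T\<^sub>P'_affine affine_inv_complement_map
    by (intro affine_map_comp)
  moreover have "affine_map (\<lambda>X. \<rho> *\<^sub>R X + t)"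
    unfolding affine_map_def by (intro exI[of _ "\<lambda>X. \<rho> *\<^sub>R X"] exI[of _ t]) (auto simp: linear_iff algebra_simps)
  moreover have "M A = \<rho> *\<^sub>R A + t" "M B = \<rho> *\<^sub>R B + t" "M C = \<rho> *\<^sub>R C + t"
    unfolding M_vertices bary_point_def k unfolding sq \<rho>_def t_def
    by (simp_all add: algebra_simps)
  ultimately have "M = (\<lambda>X. \<rho> *\<^sub>R X + t)" by (rule affine_map_ext)
  then show ?thesis using that[of t] by (simp add: \<rho>_def k_def)
qed

lemma translation_iff: "translation_map M \<longleftrightarrow> cubic = 0"
proof -
  let ?k = "(q + r) * (r + p) * (p + q)"
  define \<rho> where "\<rho> = - 4 * p * q * r / ?k"
  obtain t where M: "\<And>X. M X = \<rho> *\<^sub>R X + t" using M_homothety unfolding \<rho>_def by blast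
  have "translation_map M \<longleftrightarrow> \<rho> = 1"
  proof
    assume "translation_map M"
    then obtain t' where "\<And>X. M X = X + t'" by (auto simp: translation_map_def)
    then have "M A - M B = A - B" by simp
    then have "(\<rho> - 1) *\<^sub>R (A - B) = 0" by (simp add: M algebra_simps)
    moreover have "A \<noteq> B" using non_collinear by auto
    ultimately show "\<rho> = 1" by simp
  qed (simp add: translation_map_def M)
  also have "\<rho> = 1 \<longleftrightarrow> - 4 * p * q * r = ?k"
    unfolding \<rho>_def by (rule right_inverse_eq[OF product_nonzero])
  also have "\<dots> \<longleftrightarrow> cubic = 0" unfolding product_eq_cubic by auto
  finally show ?thesis .
qed

subsection \<open>The generalized circumcenters\<close>

definition "O\<^sub>P = inv T\<^sub>P' (K Q)"
definition "O\<^sub>P' = inv T\<^sub>P (K Q')"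

lemma O\<^sub>P_sum:
  "p * (q + r)\<^sup>2 * (p * q + q * r + r * p - p\<^sup>2) + q * (r + p)\<^sup>2 * (p * q + q * r + r * p - q\<^sup>2)
    + r * (p + q)\<^sup>2 * (p * q + q * r + r * p - r\<^sup>2) = 8 * p * q * r * (p * q + q * r + r * p)"
  by algebra

lemma O\<^sub>P'_sum:
  "(q + r)\<^sup>2 * (p\<^sup>2 + p * q + r * p - q * r) + (r + p)\<^sup>2 * (q\<^sup>2 + q * r + p * q - r * p)
    + (p + q)\<^sup>2 * (r\<^sup>2 + r * p + q * r - p * q) = 8 * p * q * r * (p + q + r)"
  by algebra

text \<open>
  As \<open>T\<^sub>P'\<close> and \<open>T\<^sub>P\<close> are injective, it is enough to verify that they map the stated points to
  \<open>K Q\<close> and \<open>K Q'\<close>.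
\<close>

lemma O\<^sub>P_bp:
  "O\<^sub>P = bp (p * (q + r)\<^sup>2 * (p * q + q * r + r * p - p\<^sup>2)) (q * (r + p)\<^sup>2 * (p * q + q * r + r * p - q\<^sup>2))
    (r * (p + q)\<^sup>2 * (p * q + q * r + r * p - r\<^sup>2))" (is "_ = ?X")
proof -
  have "T\<^sub>P' ?X = bp (q * (r + p) + r * (p + q)) (r * (p + q) + p * (q + r)) (p * (q + r) + q * (r + p))"
    by (rule trans[OF T\<^sub>P'_bp bary_point_cong[of _ "2 * p * q * r * (q + r) * (r + p) * (p + q)"]],
        unfold O\<^sub>P_sum, use nonzero isotomic_sum in simp, algebra, algebra, algebra, use nonzero in simp)
  also have "\<dots> = K Q"
    unfolding Q_bp by (rule complement_map_bp[symmetric]) (unfold Q_sum, use isotomic_sum in simp)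
  finally show ?thesis unfolding O\<^sub>P_def using T\<^sub>P'_bij by (metis bij_is_inj inv_f_f)
qed

lemma O\<^sub>P'_bp:
  "O\<^sub>P' = bp ((q + r)\<^sup>2 * (p\<^sup>2 + p * q + r * p - q * r)) ((r + p)\<^sup>2 * (q\<^sup>2 + q * r + p * q - r * p))
    ((p + q)\<^sup>2 * (r\<^sup>2 + r * p + q * r - p * q))" (is "_ = ?X")
proof -
  have "T\<^sub>P ?X = bp (r + p + (p + q)) (p + q + (q + r)) (q + r + (r + p))"
    by (rule trans[OF T\<^sub>P_bp bary_point_cong[of _ "2 * p * q * r * (q + r) * (r + p) * (p + q)"]],
        unfold O\<^sub>P'_sum, use nonzero in simp, algebra, algebra, algebra, use nonzero in simp)
  also have "\<dots> = K Q'"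
    unfolding Q'_bp by (rule complement_map_bp[symmetric]) (unfold Q'_sum, use nonzero in simp)
  finally show ?thesis unfolding O\<^sub>P'_def using T\<^sub>P_bij by (metis bij_is_inj inv_f_f)
qed

lemma combination_of_quotients:
  fixes U V W :: "'a :: real_vector"
  assumes "x1 / n1 - x2 / n2 - (x3 / n3 - x4 / n4) = c * x"
    and "y1 / n1 - y2 / n2 - (y3 / n3 - y4 / n4) = c * y"
    and "z1 / n1 - z2 / n2 - (z3 / n3 - z4 / n4) = c * z"
  shows "(1 / n1) *\<^sub>R (x1 *\<^sub>R U + y1 *\<^sub>R V + z1 *\<^sub>R W) - (1 / n2) *\<^sub>R (x2 *\<^sub>R U + y2 *\<^sub>R V + z2 *\<^sub>R W)
    - ((1 / n3) *\<^sub>R (x3 *\<^sub>R U + y3 *\<^sub>R V + z3 *\<^sub>R W) - (1 / n4) *\<^sub>R (x4 *\<^sub>R U + y4 *\<^sub>R V + z4 *\<^sub>R W))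
    = c *\<^sub>R (x *\<^sub>R U + y *\<^sub>R V + z *\<^sub>R W)"
  unfolding scaleR_add_right scaleR_scaleR assms[symmetric] by (simp add: algebra_simps)

text \<open>
  The normalized coordinates of the four points have denominators \<open>2w\<close>, \<open>8Nw\<close>, \<open>2s\<close>, \<open>8Ns\<close> with
  \<open>N = pqr\<close>, \<open>s = p + q + r\<close>, \<open>w = pq + qr + rp\<close>; over the common denominator \<open>8Nsw\<close> the factor
  \<open>cubic\<close> splits off from all three coordinates.
\<close>

lemma circumcenter_defect:
  "Q - O\<^sub>P - (Q' - O\<^sub>P') =
    (cubic / (8 * p * q * r * (p * q + q * r + r * p) * (p + q + r))) *\<^sub>R
    (((q + r) * (p\<^sup>2 - q * r)) *\<^sub>R A + ((r + p) * (q\<^sup>2 - r * p)) *\<^sub>R B + ((p + q) * (r\<^sup>2 - p * q)) *\<^sub>R C)"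
proof -
  define w s where "w = p * q + q * r + r * p" and "s = p + q + r"
  have ws: "w \<noteq> 0" "s \<noteq> 0" using nonzero isotomic_sum by (simp_all add: w_def s_def)
  have coord: "x / (2 * w) - y / (8 * p * q * r * w) - (z / (2 * s) - u / (8 * p * q * r * s)) =
      cubic / (8 * p * q * r * w * s) * v"
    if "4 * p * q * r * s * x - s * y - (4 * p * q * r * w * z - w * u) = cubic * v" for x y z u v
    using ws nonzero by (simp add: divide_simps) (use that in algebra)
  have c: "p * (q + r) / (2 * w) - p * (q + r)\<^sup>2 * (w - p\<^sup>2) / (8 * p * q * r * w)
        - ((q + r) / (2 * s) - (q + r)\<^sup>2 * (p\<^sup>2 + p * q + r * p - q * r) / (8 * p * q * r * s))
      = cubic / (8 * p * q * r * w * s) * ((q + r) * (p\<^sup>2 - q * r))"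
    "q * (r + p) / (2 * w) - q * (r + p)\<^sup>2 * (w - q\<^sup>2) / (8 * p * q * r * w)
        - ((r + p) / (2 * s) - (r + p)\<^sup>2 * (q\<^sup>2 + q * r + p * q - r * p) / (8 * p * q * r * s))
      = cubic / (8 * p * q * r * w * s) * ((r + p) * (q\<^sup>2 - r * p))"
    "r * (p + q) / (2 * w) - r * (p + q)\<^sup>2 * (w - r\<^sup>2) / (8 * p * q * r * w)
        - ((p + q) / (2 * s) - (p + q)\<^sup>2 * (r\<^sup>2 + r * p + q * r - p * q) / (8 * p * q * r * s))
      = cubic / (8 * p * q * r * w * s) * ((p + q) * (r\<^sup>2 - p * q))"
    by (rule coord; unfold w_def s_def cubic_def; algebra)+
  show ?thesis
    unfolding Q_bp Q'_bp O\<^sub>P_bp O\<^sub>P'_bp bary_point_def Q_sum Q'_sum O\<^sub>P_sum O\<^sub>P'_sum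
    unfolding w_def[symmetric] s_def[symmetric]
    by (rule combination_of_quotients[OF c])
qed

text \<open>
  With \<open>k = (q + r)(r + p)(p + q)\<close> and \<open>w = pq + qr + rp\<close>, the determinant of the three coordinate
  triples is \<open>2(p - q)(q - r)(r - p)kw\<close>.
\<close>

lemma circumcenter_not_collinear: "\<not> collinear {O\<^sub>P, Q, Q'}"
proof
  assume "collinear {O\<^sub>P, Q, Q'}"
  have nz: "8 * p * q * r * (p * q + q * r + r * p) \<noteq> 0" "2 * (p * q + q * r + r * p) \<noteq> 0"
    "2 * (p + q + r) \<noteq> 0" using nonzero isotomic_sum by simp_all
  note det = collinear_bpD[OF \<open>collinear {O\<^sub>P, Q, Q'}\<close>[unfolded O\<^sub>P_bp Q_bp Q'_bp],
      unfolded O\<^sub>P_sum Q_sum Q'_sum, OF nz]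
  have "2 * ((p - q) * (q - r) * (r - p) * ((q + r) * (r + p) * (p + q)) * (p * q + q * r + r * p)) = 0"
    by (rule trans[OF _ det]) algebra
  then show False using distinct nonzero isotomic_sum by simp
qed

lemma parallelogram_iff: "parallelogram O\<^sub>P Q Q' O\<^sub>P' \<longleftrightarrow> cubic = 0"
proof -
  have "Q - O\<^sub>P = Q' - O\<^sub>P' \<longleftrightarrow> Q - O\<^sub>P - (Q' - O\<^sub>P') = 0" by simp
  also have "\<dots> \<longleftrightarrow> cubic = 0"
  proof -
    define u where "u = ((q + r) * (p\<^sup>2 - q * r)) *\<^sub>R A + ((r + p) * (q\<^sup>2 - r * p)) *\<^sub>R B + ((p + q) * (r\<^sup>2 - p * q)) *\<^sub>R C"
    \<comment> \<open>The coefficients of \<open>u\<close> add up to zero, so \<open>u = 0\<close> would make all of them zero.\<close>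
    have "u \<noteq> 0"
    proof
      assume "u = 0"
      moreover have "(q + r) * (p\<^sup>2 - q * r) + (r + p) * (q\<^sup>2 - r * p) + (p + q) * (r\<^sup>2 - p * q) = 0" by algebra
      ultimately have "hvec ((q + r) * (p\<^sup>2 - q * r)) ((r + p) * (q\<^sup>2 - r * p)) ((p + q) * (r\<^sup>2 - p * q)) = 0"
        by (simp add: prod_eq_iff hvec_components u_def)
      then have "p\<^sup>2 - q * r = 0" "q\<^sup>2 - r * p = 0" using nonzero by (simp_all add: hvec_eq_0_iff)
      then have "(p - q) * (p + q + r) = 0" by algebra
      then show False using distinct nonzero by simp
    qed
    then show ?thesis unfolding circumcenter_defect u_def[symmetric] using nonzero isotomic_sum by simp
  qed
  finally show ?thesis using circumcenter_not_collinear by (simp add: parallelogram_def)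
qed

lemma join_PP':
  "bary A B C x y z \<subseteq> join (pt P) (pt P') \<longleftrightarrow>
    x * (p * (q\<^sup>2 - r\<^sup>2)) + y * (q * (r\<^sup>2 - p\<^sup>2)) + z * (r * (p\<^sup>2 - q\<^sup>2)) = 0"
proof -
  have e: "q * (p * q) - r * (r * p) = p * (q\<^sup>2 - r\<^sup>2)" "r * (q * r) - p * (p * q) = q * (r\<^sup>2 - p\<^sup>2)"
    "p * (r * p) - q * (q * r) = r * (p\<^sup>2 - q\<^sup>2)" by algebra+
  have "q\<^sup>2 - r\<^sup>2 = (q + r) * (q - r)" by algebra
  then have "p * (q\<^sup>2 - r\<^sup>2) \<noteq> 0" using nonzero distinct by simp
  then show ?thesis unfolding pt_P pt_P' by (subst bary_subset_join_iff; simp only: e simp_thms)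
qed

lemma circumcenter_on_join: "pt O\<^sub>P \<subseteq> join (pt P) (pt P') \<longleftrightarrow> cubic = 0"
  and circumcenter'_on_join: "pt O\<^sub>P' \<subseteq> join (pt P) (pt P') \<longleftrightarrow> cubic = 0"
proof -
  have "pt O\<^sub>P \<subseteq> join (pt P) (pt P') \<longleftrightarrow>
      (p - q) * (q - r) * (r - p) * (p * q + q * r + r * p) * cubic = 0"
    unfolding O\<^sub>P_bp
    by (subst pt_bp, unfold O\<^sub>P_sum, use nonzero isotomic_sum in simp, unfold join_PP' cubic_def,
        rule arg_cong[where f = "\<lambda>x. x = 0"], algebra)
  then show "pt O\<^sub>P \<subseteq> join (pt P) (pt P') \<longleftrightarrow> cubic = 0"
    using distinct isotomic_sum by simp
  have "pt O\<^sub>P' \<subseteq> join (pt P) (pt P') \<longleftrightarrow>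
      (p - q) * (q - r) * (r - p) * (p + q + r) * cubic = 0"
    unfolding O\<^sub>P'_bp
    by (subst pt_bp, unfold O\<^sub>P'_sum, use nonzero in simp, unfold join_PP' cubic_def,
        rule arg_cong[where f = "\<lambda>x. x = 0"], algebra)
  then show "pt O\<^sub>P' \<subseteq> join (pt P) (pt P') \<longleftrightarrow> cubic = 0"
    using distinct nonzero by simp
qed

subsection \<open>The conic through the vertices and the two points\<close>

definition "V = join (pt P) (pt Q) \<inter> join (pt P') (pt Q')"
definition "C\<^sub>P = conic_through {pt A, pt B, pt C, pt P, pt Q}"
definition "Z = conic_center C\<^sub>P"

lemma pt_vertex: "pt A = bary A B C 1 0 0" "pt B = bary A B C 0 1 0" "pt C = bary A B C 0 0 1"
  using pt_bp[of 1 0 0] pt_bp[of 0 1 0] pt_bp[of 0 0 1] by (simp_all add: bp_vertex)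

lemma V_sum:
  "p * (q\<^sup>2 + q * r + r\<^sup>2) + q * (r\<^sup>2 + r * p + p\<^sup>2) + r * (p\<^sup>2 + p * q + q\<^sup>2)
    = (p + q + r) * (p * q + q * r + r * p)"
  by algebra

lemma V_bary: "V = bary A B C (p * (q\<^sup>2 + q * r + r\<^sup>2)) (q * (r\<^sup>2 + r * p + p\<^sup>2)) (r * (p\<^sup>2 + p * q + q\<^sup>2))"
proof -
  have "(p + q + r) * (p * q + q * r + r * p) \<noteq> 0" using nonzero isotomic_sum by simp
  then have nz: "p * (q\<^sup>2 + q * r + r\<^sup>2) \<noteq> 0 \<or> q * (r\<^sup>2 + r * p + p\<^sup>2) \<noteq> 0 \<or> r * (p\<^sup>2 + p * q + q\<^sup>2) \<noteq> 0"
    using V_sum by auto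
  have "(p - q) * (q - r) * (r - p) \<noteq> 0" using distinct by simp
  then show ?thesis
    unfolding V_def pt_P pt_Q pt_P' pt_Q'
    by (rule meet_joins[OF refl refl refl refl refl refl _ _ _ _ nz, rotated -1]) algebra+
qed

text \<open>
  Passing through the vertices kills the squares.  What remains of the conditions for \<open>P\<close> and \<open>Q\<close> is,
  up to factors, that \<open>(d, e, f)\<close> is orthogonal to \<open>(qr, rp, pq)\<close> and to \<open>(p, q, r)\<close>, hence
  proportional to the cross product of these two triples.
\<close>

lemma C\<^sub>P_pole:
  "pole C\<^sub>P l = {u. \<forall>v\<in>l. qform 0 0 0 (p * (q\<^sup>2 - r\<^sup>2)) (q * (r\<^sup>2 - p\<^sup>2)) (r * (p\<^sup>2 - q\<^sup>2)) u v = 0}"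
proof -
  let ?d = "p * (q\<^sup>2 - r\<^sup>2)" and ?e = "q * (r\<^sup>2 - p\<^sup>2)" and ?f = "r * (p\<^sup>2 - q\<^sup>2)"
  let ?X = "{pt A, pt B, pt C, pt P, pt Q}"
  have fac: "?d = p * (q + r) * (q - r)" "?e = q * (r + p) * (r - p)" "?f = r * (p + q) * (p - q)"
    by algebra+
  have d: "?d \<noteq> 0" and e: "?e \<noteq> 0" and f: "?f \<noteq> 0"
    unfolding fac using nonzero distinct by simp_all
  have det: "0 * 0 * 0 + 2 * ?d * ?e * ?f - 0 * ?d\<^sup>2 - 0 * ?e\<^sup>2 - 0 * ?f\<^sup>2 \<noteq> 0"
    using d e f by simp
  have incl: "?X \<subseteq> conic_of (qform 0 0 0 ?d ?e ?f)"
    unfolding pt_vertex pt_P pt_Q insert_subset bary_mem_conic_of_iff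
  proof (intro conjI)
    show "0 * p\<^sup>2 + 0 * q\<^sup>2 + 0 * r\<^sup>2 + 2 * ?d * q * r + 2 * ?e * r * p + 2 * ?f * p * q = 0" by algebra
    show "0 * (p * (q + r))\<^sup>2 + 0 * (q * (r + p))\<^sup>2 + 0 * (r * (p + q))\<^sup>2 + 2 * ?d * (q * (r + p)) * (r * (p + q))
      + 2 * ?e * (r * (p + q)) * (p * (q + r)) + 2 * ?f * (p * (q + r)) * (q * (r + p)) = 0" by algebra
  qed (use nonzero in auto)
  have unique: "\<exists>k. a' = k * 0 \<and> b' = k * 0 \<and> c' = k * 0 \<and> d' = k * ?d \<and> e' = k * ?e \<and> f' = k * ?f"
    if sub: "?X \<subseteq> conic_of (qform a' b' c' d' e' f')" for a' b' c' d' e' f'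
  proof -
    have abc: "a' = 0" "b' = 0" "c' = 0"
      using sub unfolding pt_vertex insert_subset bary_mem_conic_of_iff by simp_all
    have "a' * p\<^sup>2 + b' * q\<^sup>2 + c' * r\<^sup>2 + 2 * d' * q * r + 2 * e' * r * p + 2 * f' * p * q = 0"
      "a' * (p * (q + r))\<^sup>2 + b' * (q * (r + p))\<^sup>2 + c' * (r * (p + q))\<^sup>2 + 2 * d' * (q * (r + p)) * (r * (p + q))
        + 2 * e' * (r * (p + q)) * (p * (q + r)) + 2 * f' * (p * (q + r)) * (q * (r + p)) = 0"
      using sub unfolding pt_P pt_Q insert_subset bary_mem_conic_of_iff by blast+
    then have 1: "d' * q * r + e' * r * p + f' * p * q = 0"
      and 2: "d' * (q * (r + p)) * (r * (p + q)) + e' * (r * (p + q)) * (p * (q + r)) + f' * (p * (q + r)) * (q * (r + p)) = 0"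
      unfolding abc by algebra+
    \<comment> \<open>As \<open>(r + p)(p + q) = p\<^sup>2 + w\<close> with \<open>w = pq + qr + rp\<close>, subtracting \<open>w\<close> times the
      equation for \<open>P\<close> from the one for \<open>Q\<close> leaves a multiple of \<open>pqr\<close>.\<close>
    have "p * q * r * (d' * p + e' * q + f' * r) = 0" using 1 2 by algebra
    then have 3: "d' * p + e' * q + f' * r = 0" using nonzero by simp
    have "?d * e' = d' * ?e" "?d * f' = d' * ?f" using 1 3 by algebra+
    then have "d' = d' / ?d * ?d" "e' = d' / ?d * ?e" "f' = d' / ?d * ?f"
      using d by (simp_all add: eq_divide_eq mult.commute)
    then show ?thesis unfolding abc by (intro exI[of _ "d' / ?d"]) simp
  qed
  show "pole C\<^sub>P l = {u. \<forall>v\<in>l. qform 0 0 0 ?d ?e ?f u v = 0}"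
    unfolding C\<^sub>P_def by (rule conic_through_qform(2)[OF det _ incl unique]) auto
qed

lemma Z_sum: "p * (q - r)\<^sup>2 + q * (r - p)\<^sup>2 + r * (p - q)\<^sup>2 = cubic - 12 * p * q * r"
  unfolding cubic_def by algebra

text \<open>
  The pole of the line \<open>x + y + z = 0\<close> is the vector whose image under the matrix of the form has three
  equal entries \<open>m\<close>; solving these equations gives the coordinates.
\<close>

lemma Z_bary: "Z = bary A B C (p * (q - r)\<^sup>2) (q * (r - p)\<^sup>2) (r * (p - q)\<^sup>2)"
proof -
  let ?d = "p * (q\<^sup>2 - r\<^sup>2)" and ?e = "q * (r\<^sup>2 - p\<^sup>2)" and ?f = "r * (p\<^sup>2 - q\<^sup>2)"
  let ?\<Delta> = "(p - q) * (q - r) * (r - p)"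
  have "hvec x y z \<in> Z \<longleftrightarrow> hvec x y z \<in> bary A B C (p * (q - r)\<^sup>2) (q * (r - p)\<^sup>2) (r * (p - q)\<^sup>2)" for x y z
  proof
    assume "hvec x y z \<in> Z"
    then have polar: "qform 0 0 0 ?d ?e ?f (hvec x y z) v = 0" if "v \<in> line_infinity" for v
      using that unfolding Z_def conic_center_def C\<^sub>P_pole by blast
    define m where "m = ?f * y + ?e * z"
    have m: "?f * y + ?e * z = m" "?f * x + ?d * z = m" "?e * x + ?d * y = m"
      using polar[of "hvec 1 (-1) 0"] polar[of "hvec 1 0 (-1)"]
      by (simp_all add: m_def line_infinity_hvec qform_hvec algebra_simps)
    have "2 * ?e * ?f * x = ?e * (?f * x + ?d * z) + ?f * (?e * x + ?d * y) - ?d * (?f * y + ?e * z)"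
      "2 * ?f * ?d * y = ?f * (?e * x + ?d * y) + ?d * (?f * y + ?e * z) - ?e * (?f * x + ?d * z)"
      "2 * ?d * ?e * z = ?d * (?f * y + ?e * z) + ?e * (?f * x + ?d * z) - ?f * (?e * x + ?d * y)"
      by algebra+
    then have sol: "2 * ?e * ?f * x - (?e * m + ?f * m - ?d * m) = 0"
      "2 * ?f * ?d * y - (?f * m + ?d * m - ?e * m) = 0"
      "2 * ?d * ?e * z - (?d * m + ?e * m - ?f * m) = 0"
      unfolding m by simp_all
    have "(r + p) * (p + q) * (2 * q * r * (r - p) * (p - q) * x + m * (q - r)) = 0"
      by (rule trans[OF _ sol(1)]) algebra
    moreover have "(p + q) * (q + r) * (2 * r * p * (p - q) * (q - r) * y + m * (r - p)) = 0"
      by (rule trans[OF _ sol(2)]) algebra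
    moreover have "(q + r) * (r + p) * (2 * p * q * (q - r) * (r - p) * z + m * (p - q)) = 0"
      by (rule trans[OF _ sol(3)]) algebra
    ultimately have "2 * q * r * (r - p) * (p - q) * x + m * (q - r) = 0"
      "2 * r * p * (p - q) * (q - r) * y + m * (r - p) = 0"
      "2 * p * q * (q - r) * (r - p) * z + m * (p - q) = 0"
      using nonzero by simp_all
    then have *: "2 * p * q * r * ?\<Delta> * x = - m * (p * (q - r)\<^sup>2)"
      "2 * p * q * r * ?\<Delta> * y = - m * (q * (r - p)\<^sup>2)"
      "2 * p * q * r * ?\<Delta> * z = - m * (r * (p - q)\<^sup>2)"
      by algebra+
    have "2 * p * q * r * ?\<Delta> \<noteq> 0" using nonzero distinct by simp
    then have "x = - m / (2 * p * q * r * ?\<Delta>) * (p * (q - r)\<^sup>2)"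
      "y = - m / (2 * p * q * r * ?\<Delta>) * (q * (r - p)\<^sup>2)"
      "z = - m / (2 * p * q * r * ?\<Delta>) * (r * (p - q)\<^sup>2)"
      unfolding times_divide_eq_left *[symmetric] by simp_all
    then show "hvec x y z \<in> bary A B C (p * (q - r)\<^sup>2) (q * (r - p)\<^sup>2) (r * (p - q)\<^sup>2)"
      unfolding mem_bary_iff by blast
  next
    assume "hvec x y z \<in> bary A B C (p * (q - r)\<^sup>2) (q * (r - p)\<^sup>2) (r * (p - q)\<^sup>2)"
    then obtain h where h: "x = h * (p * (q - r)\<^sup>2)" "y = h * (q * (r - p)\<^sup>2)" "z = h * (r * (p - q)\<^sup>2)"
      unfolding mem_bary_iff by blast
    have "qform 0 0 0 ?d ?e ?f (hvec x y z) v = 0" if "v \<in> line_infinity" for v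
    proof -
      obtain x' y' z' where v: "v = hvec x' y' z'" by (rule hvec_surj)
      have "x' + y' + z' = 0" using that unfolding v line_infinity_hvec .
      then show ?thesis unfolding v qform_hvec h by algebra
    qed
    then show "hvec x y z \<in> Z" unfolding Z_def conic_center_def C\<^sub>P_pole by blast
  qed
  then show ?thesis by (metis hvec_surj set_eqI)
qed

lemma center_on_join_iff: "Z \<subseteq> join (pt Q) (pt Q') \<longleftrightarrow> cubic = 0"
proof -
  have l: "q * (r + p) * (p + q) - r * (p + q) * (r + p) = (q - r) * (r + p) * (p + q)" by algebra
  have "Z \<subseteq> join (pt Q) (pt Q') \<longleftrightarrow> (p - q) * (q - r) * (r - p) * cubic = 0"
    unfolding Z_bary pt_Q pt_Q'
  proof (subst bary_subset_join_iff)
    show "q * (r + p) * (p + q) - r * (p + q) * (r + p) \<noteq> 0 \<or>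
        r * (p + q) * (q + r) - p * (q + r) * (p + q) \<noteq> 0 \<or>
        p * (q + r) * (r + p) - q * (r + p) * (q + r) \<noteq> 0"
      unfolding l using nonzero distinct by simp
  qed (unfold cubic_def, rule arg_cong[where f = "\<lambda>x. x = 0"], algebra)
  then show ?thesis using distinct by simp
qed

text \<open>
  If \<open>p(q\<^sup>2 + r\<^sup>2)\<close>, \<open>q(r\<^sup>2 + p\<^sup>2)\<close>, \<open>r(p\<^sup>2 + q\<^sup>2)\<close> were all equal, then \<open>r\<^sup>2 = pq\<close> and \<open>p\<^sup>2 = qr\<close>, since
  \<open>p(q\<^sup>2 + r\<^sup>2) - q(r\<^sup>2 + p\<^sup>2) = (p - q)(r\<^sup>2 - pq)\<close>, and so \<open>p = r\<close>.
\<close>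

lemma coordinates_separate:
  assumes "\<alpha> * (p * (q\<^sup>2 + r\<^sup>2)) = \<beta>" "\<alpha> * (q * (r\<^sup>2 + p\<^sup>2)) = \<beta>" "\<alpha> * (r * (p\<^sup>2 + q\<^sup>2)) = \<beta>"
  shows "\<alpha> = 0"
proof (rule ccontr)
  assume "\<alpha> \<noteq> 0"
  have "\<alpha> * ((p - q) * (r\<^sup>2 - p * q)) = \<alpha> * (p * (q\<^sup>2 + r\<^sup>2)) - \<alpha> * (q * (r\<^sup>2 + p\<^sup>2))"
    "\<alpha> * ((q - r) * (p\<^sup>2 - q * r)) = \<alpha> * (q * (r\<^sup>2 + p\<^sup>2)) - \<alpha> * (r * (p\<^sup>2 + q\<^sup>2))"
    by algebra+
  then have "\<alpha> * ((p - q) * (r\<^sup>2 - p * q)) = 0" "\<alpha> * ((q - r) * (p\<^sup>2 - q * r)) = 0"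
    unfolding assms by simp_all
  then have "r\<^sup>2 - p * q = 0" "p\<^sup>2 - q * r = 0" using \<open>\<alpha> \<noteq> 0\<close> distinct by simp_all
  then have "(r - p) * (p + q + r) = 0" by algebra
  then show False using distinct nonzero by simp
qed

lemma V_sum_cubic: "(p + q + r) * (p * q + q * r + r * p) = cubic - 3 * p * q * r"
  unfolding cubic_def by algebra

text \<open>
  Both sides are affine in \<open>u\<close>: the coordinates of \<open>Z\<close> and \<open>V\<close> are \<open>u - 2N\<close> and \<open>u + N\<close>, where \<open>N = pqr\<close>
  and \<open>u\<close> is one of \<open>p(q\<^sup>2 + r\<^sup>2)\<close>, \<open>q(r\<^sup>2 + p\<^sup>2)\<close>, \<open>r(p\<^sup>2 + q\<^sup>2)\<close>.  Two homogeneous triples for the same point are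
  proportional; comparing the coefficients of \<open>u\<close> shows that the factor is \<open>2\<close>.
\<close>

lemma complement_iff: "ext_map (inv K) Z = ext_map K V \<longleftrightarrow> cubic = 0"
proof
  assume "ext_map (inv K) Z = ext_map K V"
  then obtain k where k:
    "q * (r - p)\<^sup>2 + r * (p - q)\<^sup>2 - p * (q - r)\<^sup>2 = k * (q * (r\<^sup>2 + r * p + p\<^sup>2) + r * (p\<^sup>2 + p * q + q\<^sup>2))"
    "r * (p - q)\<^sup>2 + p * (q - r)\<^sup>2 - q * (r - p)\<^sup>2 = k * (r * (p\<^sup>2 + p * q + q\<^sup>2) + p * (q\<^sup>2 + q * r + r\<^sup>2))"
    "p * (q - r)\<^sup>2 + q * (r - p)\<^sup>2 - r * (p - q)\<^sup>2 = k * (p * (q\<^sup>2 + q * r + r\<^sup>2) + q * (r\<^sup>2 + r * p + p\<^sup>2))"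
    unfolding Z_bary V_bary ext_inv_complement_map_bary ext_complement_map_bary
    by (rule bary_eqD)
  let ?\<beta> = "k * (cubic - 4 * p * q * r) - (cubic - 8 * p * q * r)"
  have \<beta>: "(k - 2) * (p * (q\<^sup>2 + r\<^sup>2)) = ?\<beta>" "(k - 2) * (q * (r\<^sup>2 + p\<^sup>2)) = ?\<beta>" "(k - 2) * (r * (p\<^sup>2 + q\<^sup>2)) = ?\<beta>"
    unfolding cubic_def by - (use k(1) in algebra, use k(2) in algebra, use k(3) in algebra)
  have "k - 2 = 0" by (rule coordinates_separate[OF \<beta>])
  then have "k = 2" by simp
  then show "cubic = 0" using \<beta>(1) by simp
next
  assume c: "cubic = 0"
  have "q * (r - p)\<^sup>2 + r * (p - q)\<^sup>2 - p * (q - r)\<^sup>2 = 2 * (q * (r\<^sup>2 + r * p + p\<^sup>2) + r * (p\<^sup>2 + p * q + q\<^sup>2))"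
    "r * (p - q)\<^sup>2 + p * (q - r)\<^sup>2 - q * (r - p)\<^sup>2 = 2 * (r * (p\<^sup>2 + p * q + q\<^sup>2) + p * (q\<^sup>2 + q * r + r\<^sup>2))"
    "p * (q - r)\<^sup>2 + q * (r - p)\<^sup>2 - r * (p - q)\<^sup>2 = 2 * (p * (q\<^sup>2 + q * r + r\<^sup>2) + q * (r\<^sup>2 + r * p + p\<^sup>2))"
    using c unfolding cubic_def by algebra+
  then show "ext_map (inv K) Z = ext_map K V"
    unfolding Z_bary V_bary ext_inv_complement_map_bary ext_complement_map_bary
    by (simp only: bary_scale[of 2] zero_neq_numeral not_False_eq_True)
qed

text \<open>
  The ratio \<open>1/3\<close> says \<open>4Z = 3G + V\<close>, and comparing the coefficients of \<open>p(q\<^sup>2 + r\<^sup>2)\<close>,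
  \<open>q(r\<^sup>2 + p\<^sup>2)\<close>, \<open>r(p\<^sup>2 + q\<^sup>2)\<close> determines the scaling between the two sides.  Conversely, on the
  cubic the coordinate sum of \<open>Z\<close> is \<open>-12pqr\<close>, so \<open>Z\<close> is ordinary, and it differs from \<open>V\<close>.
\<close>

lemma signed_ratio_iff: "signed_ratio_eq (pt (centroid A B C)) Z V (1/3) \<longleftrightarrow> cubic = 0"
proof -
  let ?z1 = "p * (q - r)\<^sup>2" and ?z2 = "q * (r - p)\<^sup>2" and ?z3 = "r * (p - q)\<^sup>2"
  let ?v1 = "p * (q\<^sup>2 + q * r + r\<^sup>2)" and ?v2 = "q * (r\<^sup>2 + r * p + p\<^sup>2)" and ?v3 = "r * (p\<^sup>2 + p * q + q\<^sup>2)"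
  let ?\<sigma> = "(p + q + r) * (p * q + q * r + r * p)"
  let ?W = "bp ?v1 ?v2 ?v3" and ?G = "centroid A B C"
  have \<sigma>: "?\<sigma> \<noteq> 0" using nonzero isotomic_sum by simp
  have V: "V = pt ?W" unfolding V_bary using \<sigma> by (simp add: pt_bp V_sum)
  have homG: "3 *\<^sub>R hom ?G = hvec 1 1 1"
    by (simp add: centroid_def hvec_def hom_def algebra_simps)
  have homW: "?\<sigma> *\<^sub>R hom ?W = hvec ?v1 ?v2 ?v3"
    using \<sigma> by (simp add: hom_bp V_sum)
  have hom_ratio: "Y - ?G = (1/3) *\<^sub>R (?W - Y) \<longleftrightarrow> 4 *\<^sub>R hom Y = 3 *\<^sub>R hom ?G + hom ?W" for Y
  proof -
    have "4 *\<^sub>R Y - (3 *\<^sub>R ?G + ?W) = 3 *\<^sub>R (Y - ?G - (1/3) *\<^sub>R (?W - Y))"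
      by (simp add: vec_eq_iff algebra_simps)
    then have "Y - ?G = (1/3) *\<^sub>R (?W - Y) \<longleftrightarrow> 4 *\<^sub>R Y = 3 *\<^sub>R ?G + ?W"
      by (metis (no_types) eq_iff_diff_eq_0 scaleR_eq_0_iff zero_neq_numeral)
    then show ?thesis by (simp add: hom_def)
  qed
  show ?thesis
  proof
    assume "signed_ratio_eq (pt ?G) Z V (1/3)"
    then obtain Y where Y: "Z = pt Y" "4 *\<^sub>R hom Y = 3 *\<^sub>R hom ?G + hom ?W"
      unfolding signed_ratio_eq_def V pt_inject using hom_ratio by blast
    have "hvec ?z1 ?z2 ?z3 \<in> pt Y" unfolding Y(1)[symmetric] Z_bary bary_hvec by (simp add: span_base)
    then obtain c where c: "hvec ?z1 ?z2 ?z3 = c *\<^sub>R hom Y" by (auto simp: pt_def span_singleton)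
    have "(4 * ?\<sigma>) *\<^sub>R hvec ?z1 ?z2 ?z3 = c *\<^sub>R (?\<sigma> *\<^sub>R (4 *\<^sub>R hom Y))"
      unfolding c by (simp add: mult_ac)
    also have "\<dots> = c *\<^sub>R (?\<sigma> *\<^sub>R hvec 1 1 1 + hvec ?v1 ?v2 ?v3)"
      unfolding Y(2) scaleR_add_right homG homW ..
    finally have eqs: "4 * ?\<sigma> * ?z1 = c * (?\<sigma> + ?v1)" "4 * ?\<sigma> * ?z2 = c * (?\<sigma> + ?v2)" "4 * ?\<sigma> * ?z3 = c * (?\<sigma> + ?v3)"
      unfolding hvec_scaleR hvec_add hvec_inject by (simp_all only: mult_1_right)
    let ?\<beta> = "c * (?\<sigma> + p * q * r) + 8 * p * q * r * ?\<sigma>"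
    have \<beta>: "(4 * ?\<sigma> - c) * (p * (q\<^sup>2 + r\<^sup>2)) = ?\<beta>" "(4 * ?\<sigma> - c) * (q * (r\<^sup>2 + p\<^sup>2)) = ?\<beta>"
      "(4 * ?\<sigma> - c) * (r * (p\<^sup>2 + q\<^sup>2)) = ?\<beta>"
      by - (use eqs(1) in algebra, use eqs(2) in algebra, use eqs(3) in algebra)
    have c\<sigma>: "4 * ?\<sigma> - c = 0" by (rule coordinates_separate[OF \<beta>])
    have \<beta>0: "?\<beta> = 0" using \<beta>(1) unfolding c\<sigma> mult_zero_left by (rule sym)
    have "4 * ?\<sigma> * (?\<sigma> + 3 * p * q * r) = ?\<beta> + (4 * ?\<sigma> - c) * (?\<sigma> + p * q * r)" by algebra
    then have "4 * ?\<sigma> * (?\<sigma> + 3 * p * q * r) = 0" unfolding \<beta>0 c\<sigma> by simp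
    then have "?\<sigma> + 3 * p * q * r = 0" using \<sigma> by simp
    then show "cubic = 0" unfolding V_sum_cubic by simp
  next
    assume c: "cubic = 0"
    let ?Y = "bp ?z1 ?z2 ?z3"
    have zs: "?z1 + ?z2 + ?z3 = - 12 * p * q * r" and vs: "?v1 + ?v2 + ?v3 = - 3 * p * q * r"
      unfolding Z_sum V_sum V_sum_cubic c by simp_all
    have nz: "- 12 * p * q * r \<noteq> 0" "- 3 * p * q * r \<noteq> 0" using nonzero by simp_all
    have Z: "Z = pt ?Y" unfolding Z_bary using nz by (subst pt_bp) (simp_all only: zs not_False_eq_True)
    have "?Y \<noteq> ?W"
    proof
      assume "?Y = ?W"
      from bp_inject[OF this, unfolded zs vs, OF nz]
      have "(9 * p * q * r) * (p * (q\<^sup>2 + r\<^sup>2)) = - 18 * (p * q * r)\<^sup>2"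
        "(9 * p * q * r) * (q * (r\<^sup>2 + p\<^sup>2)) = - 18 * (p * q * r)\<^sup>2"
        "(9 * p * q * r) * (r * (p\<^sup>2 + q\<^sup>2)) = - 18 * (p * q * r)\<^sup>2"
        by algebra+
      then have "9 * p * q * r = 0" by (rule coordinates_separate)
      then show False using nonzero by simp
    qed
    moreover have "4 *\<^sub>R hom ?Y = 3 *\<^sub>R hom ?G + hom ?W"
    proof -
      have "hom ?Y = (1 / (- 12 * p * q * r)) *\<^sub>R hvec ?z1 ?z2 ?z3"
        "hom ?W = (1 / (- 3 * p * q * r)) *\<^sub>R hvec ?v1 ?v2 ?v3"
        using nz by (simp_all only: hom_bp zs vs not_False_eq_True)
      moreover have "4 * (1 / (- 12 * p * q * r) * ?z1) = 1 + 1 / (- 3 * p * q * r) * ?v1"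
        "4 * (1 / (- 12 * p * q * r) * ?z2) = 1 + 1 / (- 3 * p * q * r) * ?v2"
        "4 * (1 / (- 12 * p * q * r) * ?z3) = 1 + 1 / (- 3 * p * q * r) * ?v3"
        using nonzero by (simp_all add: divide_simps) algebra+
      ultimately show ?thesis unfolding homG by (simp only: hvec_scaleR hvec_add)
    qed
    ultimately show "signed_ratio_eq (pt ?G) Z V (1/3)"
      unfolding signed_ratio_eq_def V Z using hom_ratio by blast
  qed
qed

subsection \<open>The nine-point conic\<close>

definition "C\<^sub>O = ext_map (inv T\<^sub>P') ` nine_point_conic A B C P'"

lemma pt_midpoint:
  "pt (midpoint A B) = bary A B C 1 1 0" "pt (midpoint B C) = bary A B C 0 1 1"
  "pt (midpoint C A) = bary A B C 1 0 1"
proof -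
  have "midpoint A B = bp 1 1 0" "midpoint B C = bp 0 1 1" "midpoint C A = bp 1 0 1"
    by (simp_all add: midpoint_def bary_point_def inverse_eq_divide add.commute)
  then show "pt (midpoint A B) = bary A B C 1 1 0" "pt (midpoint B C) = bary A B C 0 1 1"
    "pt (midpoint C A) = bary A B C 1 0 1" by (simp_all add: pt_bp)
qed

lemma pt_midpoint_bp:
  assumes "x + y + z \<noteq> 0"
  shows "pt (midpoint A (bp x y z)) = bary A B C (2 * x + y + z) y z"
    and "pt (midpoint B (bp x y z)) = bary A B C x (x + 2 * y + z) z"
    and "pt (midpoint C (bp x y z)) = bary A B C x y (x + y + 2 * z)"
proof -
  let ?s = "x + y + z"
  have m: "hom (midpoint X (bp x y z)) = (1 / (2 * ?s)) *\<^sub>R (?s *\<^sub>R hom X + hvec x y z)" for X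
  proof -
    have "hom (midpoint X (bp x y z)) = (1/2) *\<^sub>R (hom X + hom (bp x y z))"
      by (simp add: midpoint_def hom_def inverse_eq_divide)
    then show ?thesis using assms by (simp add: hom_bp scaleR_add_right)
  qed
  have "?s *\<^sub>R hom A + hvec x y z = hvec (2 * x + y + z) y z"
    "?s *\<^sub>R hom B + hvec x y z = hvec x (x + 2 * y + z) z"
    "?s *\<^sub>R hom C + hvec x y z = hvec x y (x + y + 2 * z)"
    by (simp_all add: hvec_add hvec_scaleR add_ac flip: hvec_vertex)
  then show "pt (midpoint A (bp x y z)) = bary A B C (2 * x + y + z) y z"
    and "pt (midpoint B (bp x y z)) = bary A B C x (x + 2 * y + z) z"
    and "pt (midpoint C (bp x y z)) = bary A B C x y (x + y + 2 * z)"
    using assms by (simp_all add: pt_def bary_hvec m span_scaleR)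
qed

lemma diagonal_points:
  "join (pt A) (pt P') \<inter> join (pt B) (pt C) = bary A B C 0 r q"
  "join (pt B) (pt P') \<inter> join (pt C) (pt A) = bary A B C r 0 p"
  "join (pt C) (pt P') \<inter> join (pt A) (pt B) = bary A B C q p 0"
  unfolding pt_vertex pt_P'
  by (rule meet_joins[OF refl refl refl refl refl refl, of p] meet_joins[OF refl refl refl refl refl refl, of q]
      meet_joins[OF refl refl refl refl refl refl, of r]; use nonzero in \<open>simp; fail\<close>)+

text \<open>
  On the line \<open>BC\<close> the form vanishes at the midpoint \<open>(0 : 1 : 1)\<close> and at the trace \<open>(0 : r : q)\<close>,
  so there it is a multiple of \<open>(y - z)(qy - rz)\<close>.  The three sides fit together only
  with the same factor, so that these six points already determine the conic
  \<open>px\<^sup>2 + qy\<^sup>2 + rz\<^sup>2 - (q + r)yz - (r + p)zx - (p + q)xy = 0\<close>; the coefficients are doubled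
  to avoid fractions.
\<close>

lemma nine_point_conic_eq:
  "nine_point_conic A B C P' = conic_of (qform (2 * p) (2 * q) (2 * r) (-(q + r)) (-(r + p)) (-(p + q)))"
proof -
  let ?d = "-(q + r)" and ?e = "-(r + p)" and ?f = "-(p + q)"
  let ?X = "{bary A B C 1 1 0, bary A B C 0 1 1, bary A B C 1 0 1,
      bary A B C (2 * (q * r) + r * p + p * q) (r * p) (p * q),
      bary A B C (q * r) (q * r + 2 * (r * p) + p * q) (p * q),
      bary A B C (q * r) (r * p) (q * r + r * p + 2 * (p * q)),
      bary A B C 0 r q, bary A B C r 0 p, bary A B C q p 0}"
  have "2 * p * (2 * q) * (2 * r) + 2 * ?d * ?e * ?f - 2 * p * ?d\<^sup>2 - 2 * q * ?e\<^sup>2 - 2 * r * ?f\<^sup>2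
      = - 4 * ((q + r) * (r + p) * (p + q))" by algebra
  then have det: "2 * p * (2 * q) * (2 * r) + 2 * ?d * ?e * ?f - 2 * p * ?d\<^sup>2 - 2 * q * ?e\<^sup>2 - 2 * r * ?f\<^sup>2 \<noteq> 0"
    using product_nonzero by simp
  have incl: "?X \<subseteq> conic_of (qform (2 * p) (2 * q) (2 * r) ?d ?e ?f)"
    unfolding insert_subset bary_mem_conic_of_iff
    by (intro conjI; (use nonzero in \<open>simp; fail\<close> | simp add: power2_eq_square algebra_simps; fail))
  have unique: "\<exists>k. a' = k * (2 * p) \<and> b' = k * (2 * q) \<and> c' = k * (2 * r) \<and> d' = k * ?d \<and> e' = k * ?e \<and> f' = k * ?f"
    if sub: "?X \<subseteq> conic_of (qform a' b' c' d' e' f')" for a' b' c' d' e' f'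
  proof -
    have "a' + b' + 2 * f' = 0" "b' + c' + 2 * d' = 0" "a' + c' + 2 * e' = 0"
      and 1: "b' * r\<^sup>2 + c' * q\<^sup>2 + 2 * d' * r * q = 0"
      "a' * r\<^sup>2 + c' * p\<^sup>2 + 2 * e' * p * r = 0"
      using sub unfolding insert_subset bary_mem_conic_of_iff by simp_all
    then have 2: "f' = - (a' + b') / 2" "d' = - (b' + c') / 2" "e' = - (a' + c') / 2" by simp_all
    have "(r - q) * (b' * r - c' * q) = b' * r\<^sup>2 + c' * q\<^sup>2 + 2 * d' * r * q"
      "(r - p) * (a' * r - c' * p) = a' * r\<^sup>2 + c' * p\<^sup>2 + 2 * e' * p * r"
      unfolding 2 by (simp_all add: power2_eq_square field_simps)
    then have "b' * r = c' * q" "a' * r = c' * p" unfolding 1 using distinct by simp_all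
    then have "a' = c' / (2 * r) * (2 * p)" "b' = c' / (2 * r) * (2 * q)" "c' = c' / (2 * r) * (2 * r)"
      using nonzero by (simp_all add: field_simps)
    then obtain k where abc: "a' = k * (2 * p)" "b' = k * (2 * q)" "c' = k * (2 * r)" by blast
    show ?thesis unfolding 2 unfolding abc by (intro exI[of _ k]) (simp add: field_simps)
  qed
  have "conic_through ?X = conic_of (qform (2 * p) (2 * q) (2 * r) ?d ?e ?f)"
    by (rule conic_through_qform(1)[OF det _ incl unique]) auto
  then show ?thesis
    unfolding nine_point_conic_def pt_midpoint diagonal_points P'_def pt_midpoint_bp[OF P'_nonzero(7)]
    by (simp only: diagonal_points[unfolded P'_def])
qed

lemma T\<^sub>P'_P: "pt (T\<^sub>P' P) = bary A B C (q * r * (q + r) * (2 * p + q + r)) (r * p * (r + p) * (p + 2 * q + r))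
    (p * q * (p + q) * (p + q + 2 * r))"
proof -
  have "T\<^sub>P' P = bp (q * r * (q + r) * (2 * p + q + r)) (r * p * (r + p) * (p + 2 * q + r))
    (p * q * (p + q) * (p + q + 2 * r))"
    unfolding P_def
    by (rule trans[OF T\<^sub>P'_bp bary_point_cong[of _ 1]], rule nonzero, algebra, algebra, algebra, simp)
  moreover have "q * r * (q + r) * (2 * p + q + r) + r * p * (r + p) * (p + 2 * q + r) + p * q * (p + q) * (p + q + 2 * r)
      = (p + q + r) * ((q + r) * (r + p) * (p + q))" by algebra
  ultimately show ?thesis using nonzero by (simp add: pt_bp)
qed

lemma circumconic_iff: "pt P \<in> C\<^sub>O \<longleftrightarrow> cubic = 0"
proof -
  have "pt P \<in> C\<^sub>O \<longleftrightarrow> pt (T\<^sub>P' P) \<in> nine_point_conic A B C P'"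
    unfolding C\<^sub>O_def ext_map_pt[OF T\<^sub>P'_affine, symmetric] image_iff
    using ext_map_inv[OF T\<^sub>P'_affine T\<^sub>P'_bij] by metis
  also have "\<dots> \<longleftrightarrow> p * q * r * ((q + r) * (r + p) * (p + q)) * cubic = 0"
  proof -
    have "q * r * (q + r) * (2 * p + q + r) + r * p * (r + p) * (p + 2 * q + r) + p * q * (p + q) * (p + q + 2 * r)
      = (p + q + r) * ((q + r) * (r + p) * (p + q))" by algebra
    then have "q * r * (q + r) * (2 * p + q + r) \<noteq> 0 \<or> r * p * (r + p) * (p + 2 * q + r) \<noteq> 0 \<or>
        p * q * (p + q) * (p + q + 2 * r) \<noteq> 0" using nonzero by auto
    moreover have "2 * p * (q * r * (q + r) * (2 * p + q + r))\<^sup>2 + 2 * q * (r * p * (r + p) * (p + 2 * q + r))\<^sup>2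
        + 2 * r * (p * q * (p + q) * (p + q + 2 * r))\<^sup>2
        + 2 * (-(q + r)) * (r * p * (r + p) * (p + 2 * q + r)) * (p * q * (p + q) * (p + q + 2 * r))
        + 2 * (-(r + p)) * (p * q * (p + q) * (p + q + 2 * r)) * (q * r * (q + r) * (2 * p + q + r))
        + 2 * (-(p + q)) * (q * r * (q + r) * (2 * p + q + r)) * (r * p * (r + p) * (p + 2 * q + r))
      = - 4 * (p * q * r * ((q + r) * (r + p) * (p + q)) * cubic)"
      unfolding cubic_def by algebra
    ultimately show ?thesis unfolding T\<^sub>P'_P nine_point_conic_eq bary_mem_conic_of_iff by simp
  qed
  also have "\<dots> \<longleftrightarrow> cubic = 0" using nonzero by simp
  finally show ?thesis .
qed

end

section \<open>The equivalences\<close>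

context triangle
begin

text \<open>
  Scaling \<open>(x, y, z)\<close> by \<open>k\<close> scales the reciprocals by \<open>1/k\<close>, so the isotomic conjugate does not depend
  on the chosen coordinates.
\<close>

lemma isotomic_bary:
  assumes nz: "p \<noteq> 0" "q \<noteq> 0" "r \<noteq> 0"
  shows "isotomic A B C (bary A B C p q r) = bary A B C (q * r) (r * p) (p * q)"
  unfolding isotomic_def
proof (rule the_equality)
  have "bary A B C (q * r) (r * p) (p * q) = bary A B C (1/p) (1/q) (1/r)"
    using bary_scale[of "p * q * r" "1/p" "1/q" "1/r"] nz by (simp add: mult_ac)
  then show "\<exists>x y z. x \<noteq> 0 \<and> y \<noteq> 0 \<and> z \<noteq> 0 \<and> bary A B C p q r = bary A B C x y z \<and>
      bary A B C (q * r) (r * p) (p * q) = bary A B C (1/x) (1/y) (1/z)" using nz by blast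
  fix S assume "\<exists>x y z. x \<noteq> 0 \<and> y \<noteq> 0 \<and> z \<noteq> 0 \<and> bary A B C p q r = bary A B C x y z \<and>
      S = bary A B C (1/x) (1/y) (1/z)"
  then obtain x y z where xyz: "x \<noteq> 0" "y \<noteq> 0" "z \<noteq> 0" "bary A B C p q r = bary A B C x y z"
      and S: "S = bary A B C (1/x) (1/y) (1/z)" by blast
  obtain k where k: "p = k * x" "q = k * y" "r = k * z" using xyz(4) by (rule bary_eqD)
  have "q * r = (k\<^sup>2 * x * y * z) * (1/x)" "r * p = (k\<^sup>2 * x * y * z) * (1/y)" "p * q = (k\<^sup>2 * x * y * z) * (1/z)"
    using xyz(1-3) by (simp_all add: k power2_eq_square)
  moreover have "k\<^sup>2 * x * y * z \<noteq> 0" using nz xyz(1-3) by (auto simp: k)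
  ultimately show "S = bary A B C (q * r) (r * p) (p * q)"
    unfolding S by (simp only: bary_scale not_False_eq_True)
qed

lemma affine_hull_pairI: "u + v = 1 \<Longrightarrow> X = u *\<^sub>R Y + v *\<^sub>R W \<Longrightarrow> X \<in> affine hull {Y, W}"
  unfolding affine_hull_2 by blast

lemma on_side_bp:
  assumes "p + q + r = 1" "p = 0 \<or> q = 0 \<or> r = 0"
  shows "on_side A B C (bp p q r)"
proof -
  have "bp p q r = p *\<^sub>R A + q *\<^sub>R B + r *\<^sub>R C" using assms(1) by (simp add: bary_point_def)
  then show ?thesis
    using assms affine_hull_pairI[of q r _ B C] affine_hull_pairI[of r p _ C A] affine_hull_pairI[of p q _ A B]
    unfolding on_side_def by (auto simp: add.commute)
qed

lemma on_median_bp: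
  assumes "p + q + r = 1" "q = r \<or> r = p \<or> p = q"
  shows "on_median A B C (bp p q r)"
proof -
  have bp: "bp p q r = p *\<^sub>R A + q *\<^sub>R B + r *\<^sub>R C" using assms(1) by (simp add: bary_point_def)
  have m: "(2 * x) *\<^sub>R midpoint X Y = x *\<^sub>R X + x *\<^sub>R Y" for x :: real and X Y :: plane
    by (simp add: midpoint_def scaleR_add_right)
  show ?thesis using assms(2)
  proof (elim disjE)
    assume "q = r"
    then have "bp p q r = p *\<^sub>R A + (2 * q) *\<^sub>R midpoint B C" "p + 2 * q = 1"
      unfolding bp m using assms(1) by (simp_all add: add_ac)
    then have "bp p q r \<in> affine hull {A, midpoint B C}" by (intro affine_hull_pairI)
    then show ?thesis by (simp add: on_median_def)
  next
    assume "r = p"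
    then have "bp p q r = q *\<^sub>R B + (2 * r) *\<^sub>R midpoint C A" "q + 2 * r = 1"
      unfolding bp m using assms(1) by (simp_all add: add_ac)
    then have "bp p q r \<in> affine hull {B, midpoint C A}" by (intro affine_hull_pairI)
    then show ?thesis by (simp add: on_median_def)
  next
    assume "p = q"
    then have "bp p q r = r *\<^sub>R C + (2 * p) *\<^sub>R midpoint A B" "r + 2 * p = 1"
      unfolding bp m using assms(1) by (simp_all add: add_ac)
    then have "bp p q r \<in> affine hull {C, midpoint A B}" by (intro affine_hull_pairI)
    then show ?thesis by (simp add: on_median_def)
  qed
qed

lemma on_anticomplementary_side_bp:
  assumes "p + q + r = 1" "q + r = 0 \<or> r + p = 0 \<or> p + q = 0"
  defines "k \<equiv> inv (complement_map A B C)"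
  shows "on_side (k A) (k B) (k C) (bp p q r)"
proof -
  have bp: "bp p q r = p *\<^sub>R A + q *\<^sub>R B + r *\<^sub>R C" using assms(1) by (simp add: bary_point_def)
  have k: "k A = B + C - A" "k B = C + A - B" "k C = A + B - C"
    by (simp_all add: k_def inv_complement_map scaleR_2)
  show ?thesis using assms(2)
  proof (elim disjE)
    assume "q + r = 0"
    then have e: "r = - q" "p = 1" using assms(1) by simp_all
    have b: "bp p q r = A + q *\<^sub>R B - q *\<^sub>R C" unfolding bp unfolding e by (simp add: algebra_simps)
    have "bp p q r \<in> affine hull {k B, k C}"
      by (rule affine_hull_pairI[of "(1 - q) / 2" "(1 + q) / 2"])
        (simp add: field_simps, unfold b k, simp add: vec_eq_iff field_simps)
    then show ?thesis by (simp add: on_side_def)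
  next
    assume "r + p = 0"
    then have e: "p = - r" "q = 1" using assms(1) by simp_all
    have b: "bp p q r = B + r *\<^sub>R C - r *\<^sub>R A" unfolding bp unfolding e by (simp add: algebra_simps)
    have "bp p q r \<in> affine hull {k C, k A}"
      by (rule affine_hull_pairI[of "(1 - r) / 2" "(1 + r) / 2"])
        (simp add: field_simps, unfold b k, simp add: vec_eq_iff field_simps)
    then show ?thesis by (simp add: on_side_def)
  next
    assume "p + q = 0"
    then have e: "q = - p" "r = 1" using assms(1) by simp_all
    have b: "bp p q r = C + p *\<^sub>R A - p *\<^sub>R B" unfolding bp unfolding e by (simp add: algebra_simps)
    have "bp p q r \<in> affine hull {k A, k B}"
      by (rule affine_hull_pairI[of "(1 - p) / 2" "(1 + p) / 2"])
        (simp add: field_simps, unfold b k, simp add: vec_eq_iff field_simps)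
    then show ?thesis by (simp add: on_side_def)
  qed
qed

end

theorem theorem3p1:
  fixes A B C P P' G Q Q' O\<^sub>P O\<^sub>P' :: "real^2"
    and K T\<^sub>P T\<^sub>P' M :: "real^2 \<Rightarrow> real^2"
    and C\<^sub>O C\<^sub>P :: "((real^2) \<times> real) set set"
    and V Z :: "((real^2) \<times> real) set"
  assumes "\<not> collinear {A, B, C}"
    and "G = centroid A B C"
    and "K = complement_map A B C"
    and "isotomic A B C (pt P) = pt P'"
    and "\<forall>X\<in>{P, P'}. \<not> on_side A B C X \<and> \<not> on_median A B C X \<and>
           \<not> on_side (inv K A) (inv K B) (inv K C) X \<and>
           \<not> on_median (inv K A) (inv K B) (inv K C) X"
    and "Q = K P'"
    and "Q' = K P"
    and "T\<^sub>P = cevian_map A B C P"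
    and "T\<^sub>P' = cevian_map A B C P'"
    and "O\<^sub>P = inv T\<^sub>P' (K Q)"
    and "O\<^sub>P' = inv T\<^sub>P (K Q')"
    and "C\<^sub>O = ext_map (inv T\<^sub>P') ` nine_point_conic A B C P'"
    and "V = join (pt P) (pt Q) \<inter> join (pt P') (pt Q')"
    and "C\<^sub>P = conic_through {pt A, pt B, pt C, pt P, pt Q}"
    and "Z = conic_center C\<^sub>P"
    and "M = T\<^sub>P \<circ> inv K \<circ> T\<^sub>P'"
  shows "(translation_map M \<longleftrightarrow> parallelogram O\<^sub>P Q Q' O\<^sub>P') \<and>
         (translation_map M \<longleftrightarrow> pt P \<in> C\<^sub>O) \<and>
         (translation_map M \<longleftrightarrow> pt O\<^sub>P \<subseteq> join (pt P) (pt P') \<and> pt O\<^sub>P' \<subseteq> join (pt P) (pt P')) \<and>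
         (translation_map M \<longleftrightarrow> Z \<subseteq> join (pt Q) (pt Q')) \<and>
         (translation_map M \<longleftrightarrow> signed_ratio_eq (pt G) Z V (1/3)) \<and>
         (translation_map M \<longleftrightarrow> ext_map (inv K) Z = ext_map K V)"
proof -
  interpret triangle A B C using assms(1) by unfold_locales
  note K = assms(3)
  have P: "\<not> on_side A B C P" "\<not> on_median A B C P" "\<not> on_side (inv K A) (inv K B) (inv K C) P"
    using assms(5) by simp_all
  obtain p q r where Pb: "P = bp p q r" and sum: "p + q + r = 1" by (rule bp_surj)
  have nz: "p \<noteq> 0" "q \<noteq> 0" "r \<noteq> 0"
    using P(1) on_side_bp[OF sum] unfolding Pb by blast+
  have anti: "q + r \<noteq> 0" "r + p \<noteq> 0" "p + q \<noteq> 0"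
    using P(3) on_anticomplementary_side_bp[OF sum] unfolding Pb K by blast+
  have dist: "p \<noteq> q" "q \<noteq> r" "r \<noteq> p"
    using P(2) on_median_bp[OF sum] unfolding Pb by blast+
  have "pt P = bary A B C p q r" unfolding Pb using sum by (simp add: pt_bp)
  then have pP': "pt P' = bary A B C (q * r) (r * p) (p * q)"
    using assms(4) isotomic_bary[OF nz] by simp
  \<comment> \<open>The point \<open>(qr : rp : pq)\<close> is ordinary because it is \<open>P'\<close>.\<close>
  have w: "q * r + r * p + p * q \<noteq> 0"
  proof
    assume 0: "q * r + r * p + p * q = 0"
    have "hom P' \<in> bary A B C (q * r) (r * p) (p * q)"
      unfolding pP'[symmetric] by (simp add: pt_def span_base)
    then obtain k where "hom P' = k *\<^sub>R hvec (q * r) (r * p) (p * q)"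
      by (auto simp: bary_hvec span_singleton)
    from arg_cong[OF this, of snd] show False by (simp add: hom_def hvec_components 0)
  qed
  interpret c: cevian_point A B C p q r
    using nz anti dist sum w by unfold_locales (simp_all add: add_ac)
  have PP: "P = c.P" by (simp add: Pb c.P_def)
  have PP': "P' = c.P'" using pP' c.pt_P' by (metis pt_inject)
  have defs: "T\<^sub>P = c.T\<^sub>P" "T\<^sub>P' = c.T\<^sub>P'" "Q = c.Q" "Q' = c.Q'"
    by (simp_all add: assms(3,6-9) PP PP' c.T\<^sub>P_def c.T\<^sub>P'_def c.Q_def c.Q'_def)
  have defs': "O\<^sub>P = c.O\<^sub>P" "O\<^sub>P' = c.O\<^sub>P'" "C\<^sub>O = c.C\<^sub>O" "V = c.V" "Z = c.Z" "M = c.M"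
    by (simp_all add: assms(3,10-16) PP PP' defs c.O\<^sub>P_def c.O\<^sub>P'_def c.C\<^sub>O_def c.V_def c.Z_def c.C\<^sub>P_def c.M_def)
  show ?thesis
    unfolding defs defs' PP PP' assms(2) K
    using c.translation_iff c.parallelogram_iff c.circumconic_iff c.circumcenter_on_join
      c.circumcenter'_on_join c.center_on_join_iff c.signed_ratio_iff c.complement_iff
    by blast
qed

end
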